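(* Let $k\geq 2$ be an integer. For integers $m$ and non-negative integers $n,j$, define the numbers $\overline{N}_k(m,n,j)$ by the formal power series identity \[ \sum_{n=0}^\infty\sum_{j=0}^\infty\overline{N}_k(m,n,j)a^jq^n =\frac{(-aq;q)_\infty}{(q;q)_\infty} \sum_{n=1}^\infty(-1)^{n-1}a^nq^{(k-1)n^2+|m|n}(1-q^n)\frac{(-1/a;q)_n}{(-aq;q)_n}. \] Then \[ \sum_{m=-\infty}^\infty\sum_{n=0}^\infty\sum_{j=0}^\infty\overline{N}_k(m,n,j)a^jq^nz^m =\sum_{n_1\geq n_2\geq\cdots\geq n_{k-1}\geq1} \frac{a^{n_1}q^{\binom{n_1+1}{2}+n_2^2+\cdots+n_{k-1}^2}(-1/a;q)_{n_1}} {(q;q)_{n_1-n_2}\cdots(q;q)_{n_{k-2}-n_{k-1}}(zq;q)_{n_{k-1}}(z^{-1}q;q)_{n_{k-1}}}, \] where for $k=2$ the product $(q;q)_{n_1-n_2}\cdots(q;q)_{n_{k-2}-n_{k-1}}$ is empty (equal to $1$) and the sum is over $n_1\geq 1$.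
   Context: Standard $q$-Pochhammer notation: $(x;q)_\infty=\prod_{i\geq 0}(1-xq^i)$ and $(x;q)_n=(x;q)_\infty/(xq^n;q)_\infty$ (so $(x;q)_n=\prod_{i=0}^{n-1}(1-xq^i)$ for $n\ge 0$). Note $a^n(-1/a;q)_n=\prod_{i=0}^{n-1}(a+q^i)$ is a polynomial in $a$. The identities are identities of formal power series in $q$ (with coefficients polynomials/Laurent series in $a$ and $z$). *)

theory Defs
  imports
    "HOL-Analysis.Analysis"
    "HOL-Computational_Algebra.Formal_Laurent_Series"
begin

text \<open>
  Everything lives in \<open>K[[q]]\<close>, where \<open>q\<close> is \<^const>\<open>fps_X\<close> and \<open>K\<close> is a field of formal Laurent
  series, so that \<open>1/a\<close> and \<open>1/z\<close> exist. The metric on formal power series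
  is the \<open>q\<close>-adic one (the coefficients carry the discrete topology), so infinite sums and products
  are formal ones: every coefficient of \<open>q ^ n\<close> is eventually constant.
\<close>

definition qpoch :: "'a::field fps \<Rightarrow> nat \<Rightarrow> 'a fps" where
  "qpoch x n = (\<Prod>i<n. 1 - x * fps_X ^ i)"

definition qpoch_inf :: "'a::field fps \<Rightarrow> 'a fps" where
  "qpoch_inf x = (\<Prod>i. 1 - x * fps_X ^ i)"

definition Nbar_series :: "'a::field fps \<Rightarrow> nat \<Rightarrow> int \<Rightarrow> 'a fps" where
  "Nbar_series a k m =
     qpoch_inf (- a * fps_X) / qpoch_inf fps_X *
     (\<Sum>\<^sub>\<infinity>n\<in>{1..}. (-1) ^ (n - 1) * a ^ n * fps_X ^ ((k - 1) * n\<^sup>2 + nat \<bar>m\<bar> * n) * (1 - fps_X ^ n)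
        * (qpoch (- 1 / a) n / qpoch (- a * fps_X) n))"

text \<open>
  The coefficient of \<open>a ^ j * q ^ n\<close>; here \<open>a\<close> is the Laurent variable. That no negative powers of
  \<open>a\<close> are lost by restricting to \<open>j :: nat\<close> is the content of \<open>has_sum_Nbar\<close> below.
\<close>

definition Nbar :: "nat \<Rightarrow> int \<Rightarrow> nat \<Rightarrow> nat \<Rightarrow> rat" where
  "Nbar k m n j = fls_nth (fps_nth (Nbar_series (fps_const fls_X) k m) n) (int j)"

text \<open>The index tuples \<open>n\<^sub>1 \<ge> n\<^sub>2 \<ge> \<dots> \<ge> n\<^sub>r \<ge> 1\<close>, as functions on \<open>{1..r}\<close>.\<close>

definition desc_tuples :: "nat \<Rightarrow> (nat \<Rightarrow> nat) set" where
  "desc_tuples r = {\<nu> \<in> {1..r} \<rightarrow>\<^sub>E {1..}. \<forall>i\<in>{1..<r}. \<nu> i \<ge> \<nu> (Suc i)}"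

definition multisum_term :: "'a::field fps \<Rightarrow> 'a fps \<Rightarrow> nat \<Rightarrow> (nat \<Rightarrow> nat) \<Rightarrow> 'a fps" where
  "multisum_term a z k \<nu> =
     a ^ \<nu> 1 * fps_X ^ ((\<nu> 1 + 1 choose 2) + (\<Sum>i=2..k-1. (\<nu> i)\<^sup>2)) * qpoch (- 1 / a) (\<nu> 1) /
     ((\<Prod>i=1..<k-1. qpoch fps_X (\<nu> i - \<nu> (Suc i)))
       * qpoch (z * fps_X) (\<nu> (k - 1)) * qpoch (inverse z * fps_X) (\<nu> (k - 1)))"


subsection \<open>The definitions are well posed\<close>

lemma qpoch_nth_stable: "n < N \<Longrightarrow> fps_nth (qpoch x N) n = fps_nth (qpoch x (Suc n)) n"
proof (induction N)
  case (Suc N)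
  show ?case
  proof (cases "n = N")
    case False
    with Suc have n: "n < N" by simp
    have "qpoch x (Suc N) = qpoch x N - fps_X ^ N * (x * qpoch x N)"
      by (simp add: qpoch_def algebra_simps)
    with n Suc.IH show ?thesis by (simp add: fps_X_power_mult_nth)
  qed simp
qed simp

lemma qpoch_nth_0: "fps_nth x 0 = 0 \<Longrightarrow> fps_nth (qpoch x n) 0 = 1"
  by (induction n) (simp_all add: qpoch_def)

lemma has_prod_qpoch_inf:
  fixes x :: "'a::field fps"
  assumes "fps_nth x 0 = 0"
  shows "(\<lambda>i. 1 - x * fps_X ^ i) has_prod qpoch_inf x"
    and "fps_nth (qpoch_inf x) n = fps_nth (qpoch x (Suc n)) n"
proof -
  define P where "P = Abs_fps (\<lambda>n. fps_nth (qpoch x (Suc n)) n)"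
  have "(\<lambda>n. \<Prod>i\<le>n. 1 - x * fps_X ^ i) \<longlonglongrightarrow> P"
  proof (rule tendsto_fpsI)
    fix n
    show "\<forall>\<^sub>F N in sequentially. fps_nth (\<Prod>i\<le>N. 1 - x * fps_X ^ i) n = fps_nth P n"
      using eventually_ge_at_top[of n]
    proof eventually_elim
      case (elim N)
      then show ?case
        using qpoch_nth_stable[of n "Suc N" x] by (simp add: P_def qpoch_def lessThan_Suc_atMost)
    qed
  qed
  moreover have "fps_nth P 0 = 1"
    using assms by (simp add: P_def qpoch_nth_0)
  hence "P \<noteq> 0" by auto
  ultimately have *: "(\<lambda>i. 1 - x * fps_X ^ i) has_prod P"
    by (simp add: has_prod_def raw_has_prod_def)
  moreover from * have "qpoch_inf x = P"
    unfolding qpoch_inf_def by (rule has_prod_unique[symmetric])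
  ultimately show "(\<lambda>i. 1 - x * fps_X ^ i) has_prod qpoch_inf x"
    and "fps_nth (qpoch_inf x) n = fps_nth (qpoch x (Suc n)) n"
    by (simp_all add: P_def)
qed

lemma fps_has_sumI:
  fixes f :: "'b \<Rightarrow> 'a::comm_ring_1 fps"
  assumes fin: "\<And>n. finite {x \<in> A. fps_nth (f x) n \<noteq> 0}"
    and S: "\<And>n. fps_nth S n = (\<Sum>x | x \<in> A \<and> fps_nth (f x) n \<noteq> 0. fps_nth (f x) n)"
  shows "(f has_sum S) A"
  unfolding has_sum_def
proof (rule tendsto_fpsI)
  fix n
  define F where "F = {x \<in> A. fps_nth (f x) n \<noteq> 0}"
  have "fps_nth (sum f G) n = fps_nth S n" if "finite G" "F \<subseteq> G" "G \<subseteq> A" for G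
  proof -
    have "fps_nth (sum f G) n = (\<Sum>x\<in>G. fps_nth (f x) n)" by (simp add: fps_sum_nth)
    also have "\<dots> = (\<Sum>x\<in>F. fps_nth (f x) n)"
      using that by (intro sum.mono_neutral_right) (auto simp: F_def)
    finally show ?thesis using S by (simp add: F_def)
  qed
  thus "\<forall>\<^sub>F G in finite_subsets_at_top A. fps_nth (sum f G) n = fps_nth S n"
    unfolding eventually_finite_subsets_at_top using fin[of n]
    by (intro exI[of _ F]) (auto simp: F_def)
qed

lemma summable_Nbar_series:
  fixes a :: "'a::field fps"
  assumes "k \<ge> 2"
  shows "(\<lambda>n. (-1) ^ (n - 1) * a ^ n * fps_X ^ ((k - 1) * n\<^sup>2 + nat \<bar>m\<bar> * n) * (1 - fps_X ^ n)
        * (qpoch (- 1 / a) n / qpoch (- a * fps_X) n)) summable_on {1..}"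
    (is "?f summable_on _")
proof -
  have "fps_nth (?f n) N = 0" if "N < n" for n N
  proof -
    have "n * 1 \<le> n * n" using that by (intro mult_le_mono) auto
    moreover have "1 * (n * n) \<le> (k - 1) * (n * n)" using assms by (intro mult_le_mono) auto
    ultimately have *: "N < (k - 1) * n\<^sup>2 + nat \<bar>m\<bar> * n"
      using that unfolding power2_eq_square by linarith
    have "?f n = fps_X ^ ((k - 1) * n\<^sup>2 + nat \<bar>m\<bar> * n) *
        ((-1) ^ (n - 1) * a ^ n * (1 - fps_X ^ n) * (qpoch (- 1 / a) n / qpoch (- a * fps_X) n))"
      by (simp only: mult_ac)
    with * show ?thesis by (simp only: fps_X_power_mult_nth if_True)
  qed
  hence "{n \<in> {1..}. fps_nth (?f n) N \<noteq> 0} \<subseteq> {..N}" for N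
    by (auto simp: not_less[symmetric])
  hence "finite {n \<in> {1..}. fps_nth (?f n) N \<noteq> 0}" for N
    using finite_subset by blast
  from fps_has_sumI[OF this, of "Abs_fps (\<lambda>N. \<Sum>n | n \<in> {1..} \<and> fps_nth (?f n) N \<noteq> 0. fps_nth (?f n) N)"]
  show ?thesis unfolding summable_on_def by (auto simp only: fps_nth_Abs_fps)
qed

definition poly_coeffs :: "'a::field fls fps \<Rightarrow> bool" where
  "poly_coeffs F \<longleftrightarrow> (\<forall>n. fps_nth F n \<in> range (\<lambda>p. fps_to_fls (fps_of_poly p)))"

lemma fls_poly_closed:
  fixes x y :: "'a::field fls"
  defines "R \<equiv> range (\<lambda>p::'a poly. fps_to_fls (fps_of_poly p))"
  shows "0 \<in> R" "1 \<in> R" "fls_X \<in> R"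
    and "x \<in> R \<Longrightarrow> y \<in> R \<Longrightarrow> x + y \<in> R"
    and "x \<in> R \<Longrightarrow> y \<in> R \<Longrightarrow> x * y \<in> R"
    and "x \<in> R \<Longrightarrow> - x \<in> R"
    and "(\<And>i. i \<in> I \<Longrightarrow> f i \<in> R) \<Longrightarrow> sum f I \<in> R"
proof -
  show 0: "0 \<in> R" unfolding R_def by (rule image_eqI[of _ _ 0]) auto
  show "1 \<in> R" unfolding R_def by (rule image_eqI[of _ _ 1]) auto
  show "fls_X \<in> R" unfolding R_def by (rule image_eqI[of _ _ "[:0, 1:]"]) auto
  show add: "x + y \<in> R" if "x \<in> R" "y \<in> R" for x y
    using that unfolding R_def by (auto simp: fps_of_poly_add[symmetric] fps_to_fls_plus[symmetric] simp del: fps_to_fls_plus)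
  show "x * y \<in> R" if "x \<in> R" "y \<in> R"
    using that unfolding R_def by (auto simp: fps_of_poly_mult[symmetric] fls_times_fps_to_fls[symmetric])
  show "- x \<in> R" if "x \<in> R"
    using that unfolding R_def by (auto simp: fps_of_poly_uminus[symmetric] fps_to_fls_uminus[symmetric] simp del: fps_to_fls_uminus)
  show "sum f I \<in> R" if "\<And>i. i \<in> I \<Longrightarrow> f i \<in> R"
    using that by (induction I rule: infinite_finite_induct) (auto simp: 0 add)
qed

lemma poly_coeffs_intros:
  shows poly_coeffs_1: "poly_coeffs 1"
    and poly_coeffs_X: "poly_coeffs fps_X"
    and poly_coeffs_a: "poly_coeffs (fps_const fls_X)"
    and poly_coeffs_add: "poly_coeffs F \<Longrightarrow> poly_coeffs G \<Longrightarrow> poly_coeffs (F + G)"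
    and poly_coeffs_uminus: "poly_coeffs F \<Longrightarrow> poly_coeffs (- F)"
    and poly_coeffs_mult: "poly_coeffs F \<Longrightarrow> poly_coeffs G \<Longrightarrow> poly_coeffs (F * G)"
  unfolding poly_coeffs_def
  by (auto simp: fps_mult_nth intro!: fls_poly_closed)

lemma poly_coeffs_diff: "poly_coeffs F \<Longrightarrow> poly_coeffs G \<Longrightarrow> poly_coeffs (F - G)"
  using poly_coeffs_add[of F "- G"] poly_coeffs_uminus[of G] by simp

lemma poly_coeffs_prod: "(\<And>i. i \<in> I \<Longrightarrow> poly_coeffs (f i)) \<Longrightarrow> poly_coeffs (prod f I)"
  by (induction I rule: infinite_finite_induct) (auto simp: poly_coeffs_1 poly_coeffs_mult)

lemma poly_coeffs_power: "poly_coeffs F \<Longrightarrow> poly_coeffs (F ^ n)"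
  by (induction n) (auto simp: poly_coeffs_1 poly_coeffs_mult)

lemma poly_coeffs_qpoch: "poly_coeffs x \<Longrightarrow> poly_coeffs (qpoch x n)"
  unfolding qpoch_def
  by (intro poly_coeffs_prod poly_coeffs_diff poly_coeffs_mult poly_coeffs_power poly_coeffs_1 poly_coeffs_X)

lemma poly_coeffs_qpoch_inf:
  "poly_coeffs x \<Longrightarrow> fps_nth x 0 = 0 \<Longrightarrow> poly_coeffs (qpoch_inf x)"
  using poly_coeffs_qpoch[of x] has_prod_qpoch_inf(2)[of x] by (simp add: poly_coeffs_def)

lemma poly_coeffs_inverse:
  assumes "poly_coeffs F" and "fps_nth F 0 = 1"
  shows "poly_coeffs (inverse F)"
  unfolding poly_coeffs_def
proof
  fix n
  show "fps_nth (inverse F) n \<in> range (\<lambda>p. fps_to_fls (fps_of_poly p))"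
  proof (induction n rule: less_induct)
    case (less n)
    show ?case
    proof (cases "n = 0")
      case True
      thus ?thesis using assms fls_poly_closed(2) by simp
    next
      case False
      have "F * inverse F = 1" using assms by (simp add: inverse_mult_eq_1')
      hence "fps_nth (F * inverse F) n = 0" using False by simp
      hence "(\<Sum>i=0..n. fps_nth F i * fps_nth (inverse F) (n - i)) = 0"
        by (simp add: fps_mult_nth)
      hence "fps_nth (inverse F) n = - (\<Sum>i=1..n. fps_nth F i * fps_nth (inverse F) (n - i))"
        using assms(2) by (simp add: sum.atLeast_Suc_atMost eq_neg_iff_add_eq_0)
      also have "\<dots> \<in> range (\<lambda>p. fps_to_fls (fps_of_poly p))"
        using assms(1) less by (intro fls_poly_closed) (auto simp: poly_coeffs_def)
      finally show ?thesis .
    qed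
  qed
qed

lemma poly_coeffs_divide:
  assumes "poly_coeffs F" "poly_coeffs G" "fps_nth G 0 = 1"
  shows "poly_coeffs (F / G)"
  using assms by (simp add: fps_divide_unit poly_coeffs_mult poly_coeffs_inverse)

lemma poly_coeffs_infsum:
  assumes "\<And>x. x \<in> A \<Longrightarrow> poly_coeffs (f x)"
  shows "poly_coeffs (infsum f A)"
proof (cases "f summable_on A")
  case True
  hence "(sum f \<longlongrightarrow> infsum f A) (finite_subsets_at_top A)"
    using has_sum_infsum has_sum_def by blast
  hence ev: "\<forall>\<^sub>F G in finite_subsets_at_top A. fps_nth (sum f G) n = fps_nth (infsum f A) n" for n
    by (simp add: tendsto_fps_iff)
  show ?thesis unfolding poly_coeffs_def
  proof
    fix n
    obtain G where "G \<subseteq> A" "fps_nth (sum f G) n = fps_nth (infsum f A) n"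
      using ev[of n] unfolding eventually_finite_subsets_at_top by blast
    moreover from \<open>G \<subseteq> A\<close> have "(\<Sum>x\<in>G. fps_nth (f x) n) \<in> range (\<lambda>p. fps_to_fls (fps_of_poly p))"
      using assms by (intro fls_poly_closed) (auto simp: poly_coeffs_def)
    ultimately show "fps_nth (infsum f A) n \<in> range (\<lambda>p. fps_to_fls (fps_of_poly p))"
      by (simp add: fps_sum_nth)
  qed
next
  case False
  thus ?thesis using fls_poly_closed(1) by (simp add: infsum_not_exists poly_coeffs_def)
qed

lemma power_mult_qpoch:
  fixes c :: "'a::field"
  assumes "c \<noteq> 0"
  shows "fps_const c ^ n * qpoch (- 1 / fps_const c) n = (\<Prod>i<n. fps_const c + fps_X ^ i)"
proof -
  have "fps_const c * (- 1 / fps_const c) = - 1"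
    using assms by (simp add: fps_divide_unit fps_const_inverse flip: fps_const_neg)
  hence "fps_const c * (1 - (- 1 / fps_const c) * fps_X ^ i) = fps_const c + fps_X ^ i" for i
    by (simp add: right_diff_distrib flip: mult.assoc)
  hence "(\<Prod>i<n. fps_const c * (1 - (- 1 / fps_const c) * fps_X ^ i)) = (\<Prod>i<n. fps_const c + fps_X ^ i)"
    by (intro prod.cong) (rule refl, blast)
  thus ?thesis
    unfolding qpoch_def prod.distrib prod_constant card_lessThan .
qed

lemma poly_coeffs_Nbar_series: "poly_coeffs (Nbar_series (fps_const fls_X) k m)"
proof -
  let ?a = "fps_const fls_X :: 'a fls fps"
  have aq: "poly_coeffs (- ?a * fps_X)"
    by (intro poly_coeffs_intros)
  have "poly_coeffs ((-1) ^ (n - 1) * ?a ^ n * fps_X ^ ((k - 1) * n\<^sup>2 + nat \<bar>m\<bar> * n) * (1 - fps_X ^ n)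
        * (qpoch (- 1 / ?a) n / qpoch (- ?a * fps_X) n))" (is "poly_coeffs ?t") for n
  proof -
    have "?t = (-1) ^ (n - 1) * fps_X ^ ((k - 1) * n\<^sup>2 + nat \<bar>m\<bar> * n) * (1 - fps_X ^ n)
        * ((\<Prod>i<n. ?a + fps_X ^ i) / qpoch (- ?a * fps_X) n)"
      by (subst power_mult_qpoch[symmetric])
         (simp_all add: fps_divide_unit qpoch_nth_0 mult_ac)
    also have "poly_coeffs \<dots>"
      using aq by (intro poly_coeffs_mult poly_coeffs_divide poly_coeffs_power poly_coeffs_diff
           poly_coeffs_prod poly_coeffs_intros poly_coeffs_qpoch qpoch_nth_0) simp_all
    finally show ?thesis .
  qed
  hence "poly_coeffs (\<Sum>\<^sub>\<infinity>n\<in>{1..}. (-1) ^ (n - 1) * ?a ^ n * fps_X ^ ((k - 1) * n\<^sup>2 + nat \<bar>m\<bar> * n)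
      * (1 - fps_X ^ n) * (qpoch (- 1 / ?a) n / qpoch (- ?a * fps_X) n))"
    by (rule poly_coeffs_infsum)
  moreover have "poly_coeffs (qpoch_inf (- ?a * fps_X) / qpoch_inf fps_X)"
    by (intro poly_coeffs_divide poly_coeffs_qpoch_inf poly_coeffs_X aq)
       (simp_all add: has_prod_qpoch_inf(2) qpoch_nth_0)
  ultimately show ?thesis
    unfolding Nbar_series_def by (intro poly_coeffs_mult)
qed

theorem has_sum_Nbar:
  "((\<lambda>(n, j). fps_const (of_rat (Nbar k m n j)) * fps_const fls_X ^ j * fps_X ^ n)
     has_sum Nbar_series (fps_const (fls_X :: rat fls)) k m) UNIV"
proof -
  let ?G = "Nbar_series (fps_const (fls_X :: rat fls)) k m"
  have "\<forall>n. \<exists>p. fps_nth ?G n = fps_to_fls (fps_of_poly p)"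
    using poly_coeffs_Nbar_series[where 'a = rat, of k m] by (auto simp: poly_coeffs_def)
  then obtain p where p: "\<And>n. fps_nth ?G n = fps_to_fls (fps_of_poly (p n))"
    by metis
  have N: "Nbar k m n j = coeff (p n) j" for n j
    by (simp add: Nbar_def p)
  have of_rat: "(of_rat c :: rat fls) = fls_const c" for c
  proof -
    obtain u v where c: "c = of_int u / of_int v" and v: "v \<noteq> 0"
      by (metis quotient_of_denom_pos quotient_of_div surj_pair less_irrefl)
    show ?thesis using v
      by (simp add: c of_rat_divide fls_of_int field_simps fls_const_mult_const flip: of_int_eq_iff)
  qed
  have to_fls_sum: "fps_to_fls (sum g I) = (\<Sum>i\<in>I. fps_to_fls (g i))" for g :: "nat \<Rightarrow> rat fps" and I
    by (induction I rule: infinite_finite_induct) simp_all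
  define f where "f = (\<lambda>(n, j). fps_const (of_rat (Nbar k m n j)) * fps_const fls_X ^ j * fps_X ^ n :: rat fls fps)"
  have f: "fps_nth (f (n, j)) i = (if i = n then fls_const (coeff (p n) j) * fls_X ^ j else 0)" for n j i
    by (simp add: f_def N of_rat fps_X_power_mult_right_nth fps_const_power)
  have nz: "{x \<in> UNIV. fps_nth (f x) n \<noteq> 0} = Pair n ` {j. coeff (p n) j \<noteq> 0}" for n
    by (auto simp: f split: if_splits)
  have "(f has_sum ?G) UNIV"
  proof (rule fps_has_sumI)
    fix n
    have fin: "finite {j. coeff (p n) j \<noteq> 0}"
      by (rule finite_subset[of _ "{..degree (p n)}"]) (auto intro: le_degree)
    show "finite {x \<in> UNIV. fps_nth (f x) n \<noteq> 0}"
      unfolding nz using fin by simp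
    have "(\<Sum>x | x \<in> UNIV \<and> fps_nth (f x) n \<noteq> 0. fps_nth (f x) n) =
        (\<Sum>j | coeff (p n) j \<noteq> 0. fls_const (coeff (p n) j) * fls_X ^ j)"
      unfolding nz by (simp add: sum.reindex inj_on_def f)
    also have "\<dots> = (\<Sum>j\<le>degree (p n). fls_const (coeff (p n) j) * fls_X ^ j)"
      by (rule sum.mono_neutral_left) (auto intro: le_degree)
    also have "\<dots> = (\<Sum>j\<le>degree (p n). fps_to_fls (fps_of_poly (monom (coeff (p n) j) j)))"
      by (simp add: fps_of_poly_monom fls_times_fps_to_fls fps_to_fls_power)
    also have "\<dots> = fps_to_fls (fps_of_poly (\<Sum>j\<le>degree (p n). monom (coeff (p n) j) j))"
      unfolding fps_of_poly_sum by (rule to_fls_sum[symmetric])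
    also have "\<dots> = fps_to_fls (fps_of_poly (p n))"
      by (simp add: poly_as_sum_of_monoms)
    finally show "fps_nth ?G n = (\<Sum>x | x \<in> UNIV \<and> fps_nth (f x) n \<noteq> 0. fps_nth (f x) n)"
      by (simp add: p)
  qed
  thus ?thesis by (simp add: f_def)
qed

end

theory Submission
  imports Defs
begin

text \<open>
  Summing \<open>z ^ m * q ^ (\<bar>m\<bar> * n)\<close> over all integers \<open>m\<close> gives \<open>(1 - q ^ (2 * n)) / ((1 - z q ^ n) (1 - q ^ n / z))\<close>,
  so the left-hand side is a single sum over \<open>n\<close>. Let \<open>\<alpha> n\<close> be
  \<open>(-1) ^ (n - 1) q ^ (n (n - 1) / 2) (1 - q ^ n) (1 - q ^ (2 n)) / ((1 - z q ^ n) (1 - q ^ n / z))\<close> and let \<open>\<beta> n\<close>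
  be \<open>1 / ((zq;q)\<^sub>n (q/z;q)\<^sub>n)\<close> for \<open>n \<ge> 1\<close>, with \<open>\<alpha> 0 = \<beta> 0 = 0\<close>. Then \<open>(\<alpha>, \<beta>)\<close> is a Bailey pair relative
  to \<open>1\<close>. Applying the Bailey lemma \<open>k - 2\<close> times with \<open>\<rho>\<^sub>1, \<rho>\<^sub>2 \<rightarrow> \<infinity>\<close>, and once more with \<open>\<rho>\<^sub>1 = -1/a\<close>,
  \<open>\<rho>\<^sub>2 \<rightarrow> \<infinity>\<close> and the upper summation bound tending to \<open>\<infinity>\<close>, turns the single sum into the multisum.
  Both kinds of step are instances of one identity, \<open>\<rho>\<^sub>1 \<rightarrow> \<infinity>\<close> being the case \<open>a = 0\<close>. Limits are taken as
  congruences modulo powers of \<open>q\<close>.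
\<close>

subsection \<open>The Bailey lemma\<close>

text \<open>This is the \<open>q\<close>-Chu-Vandermonde sum with numerator parameter
  \<open>-c/a\<close> and denominator parameter \<open>c^2 q\<close>. Here \<open>u n\<close> stands
  for \<open>1/(q;q)_n\<close> and \<open>v n\<close> for \<open>v 0 / (c^2 q;q)_n\<close>;
  recurrences and the product of \<open>a + c * q ^ i\<close> replace divisions, so that
  \<open>a = 0\<close> is covered. Both sides are linear in \<open>v\<close>, so \<open>v 0\<close>
  stays free.\<close>

lemma q_Vandermonde:
  fixes a c q :: "'a::idom" and u v :: "nat \<Rightarrow> 'a"
  assumes u0: "u 0 = 1" and u: "\<And>n. u (Suc n) * (1 - q ^ Suc n) = u n"
    and v: "\<And>n. v (Suc n) * (1 - c\<^sup>2 * q ^ Suc n) = v n"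
    and nz: "\<And>n. q ^ Suc n \<noteq> 1" "\<And>n. c\<^sup>2 * q ^ Suc n \<noteq> 1"
  shows "(\<Sum>t\<le>M. (\<Prod>i<t. a + c * q ^ i) * q ^ (Suc t choose 2) * c ^ t * u t * v t * u (M - t))
    = u M * v M * (\<Prod>i<M. 1 + a * c * q ^ Suc i)"
proof -
  define f where "f t = (\<Prod>i<t. a + c * q ^ i) * q ^ (Suc t choose 2) * c ^ t * u t * v t" for t
  have f_Suc: "f (Suc t) * (1 - q ^ Suc t) * (1 - c\<^sup>2 * q ^ Suc t) = f t * (a + c * q ^ t) * q ^ Suc t * c" for t
  proof -
    have "f (Suc t) * (1 - q ^ Suc t) * (1 - c\<^sup>2 * q ^ Suc t) =
        (\<Prod>i<Suc t. a + c * q ^ i) * q ^ (Suc (Suc t) choose 2) * c ^ Suc t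
          * (u (Suc t) * (1 - q ^ Suc t)) * (v (Suc t) * (1 - c\<^sup>2 * q ^ Suc t))"
      unfolding f_def by (simp only: mult_ac)
    also have "\<dots> = (\<Prod>i<Suc t. a + c * q ^ i) * q ^ (Suc (Suc t) choose 2) * c ^ Suc t * u t * v t"
      by (simp only: u v)
    also have "Suc (Suc t) choose 2 = (Suc t choose 2) + Suc t"
      by (simp add: numeral_2_eq_2)
    finally show ?thesis
      by (simp add: f_def power_add mult_ac)
  qed
  \<comment> \<open>The summand of the recurrence in \<open>M\<close> proved next is a difference in \<open>t\<close> (a WZ certificate).\<close>
  have partial: "(\<Sum>t\<le>T. ((1 - q ^ M) * (1 - c\<^sup>2 * q ^ M) - (1 + a * c * q ^ M) * (1 - q ^ (M - t))) * (f t * u (M - t)))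
      = - (q ^ M * c * (a + c * q ^ T) * f T * (1 - q ^ (M - T)) * u (M - T))" if "T \<le> M" for T M
    using that
  proof (induction T)
    case 0
    then show ?case by (simp add: algebra_simps power2_eq_square)
  next
    case (Suc T)
    define N where "N = M - Suc T"
    have M: "M = N + Suc T" and MT: "M - T = Suc N" and MS: "M - Suc T = N"
      using Suc.prems by (simp_all add: N_def)
    have uN: "(1 - q ^ Suc N) * u (Suc N) = u N"
      using u[of N] by (simp add: mult.commute)
    have step: "- (q ^ M * c * (a + c * q ^ T) * f T * (1 - q ^ (M - T)) * u (M - T)) =
        - (q ^ N * (f T * (a + c * q ^ T) * q ^ Suc T * c) * u N)"
      unfolding MT uN[symmetric] by (simp add: M power_add mult_ac)
    show ?case
      unfolding sum.atMost_Suc Suc.IH[OF Suc_leD[OF Suc.prems]] step f_Suc[symmetric] MS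
      unfolding M by (simp add: power_add algebra_simps power2_eq_square)
  qed
  have rec: "(1 - q ^ Suc M) * (1 - c\<^sup>2 * q ^ Suc M) * (\<Sum>t\<le>Suc M. f t * u (Suc M - t))
      = (1 + a * c * q ^ Suc M) * (\<Sum>t\<le>M. f t * u (M - t))" for M
  proof -
    have "(1 - q ^ (Suc M - t)) * u (Suc M - t) = u (M - t)" if "t \<le> M" for t
      using u[of "M - t"] that by (simp add: Suc_diff_le mult.commute)
    then have "(\<Sum>t\<le>M. f t * u (M - t)) = (\<Sum>t\<le>M. f t * ((1 - q ^ (Suc M - t)) * u (Suc M - t)))"
      by simp
    \<comment> \<open>The added term \<open>t = Suc M\<close> carries the factor
      \<open>1 - q ^ 0 = 0\<close>.\<close>
    also have "\<dots> = (\<Sum>t\<le>Suc M. (1 - q ^ (Suc M - t)) * (f t * u (Suc M - t)))"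
      by (simp add: mult_ac)
    finally have S: "(\<Sum>t\<le>M. f t * u (M - t)) = (\<Sum>t\<le>Suc M. (1 - q ^ (Suc M - t)) * (f t * u (Suc M - t)))" .
    have linear: "(\<Sum>t\<le>n. (K - L * w t) * x t) = K * (\<Sum>t\<le>n. x t) - L * (\<Sum>t\<le>n. w t * x t)"
      for K L :: 'a and w x n
      by (simp add: left_diff_distrib sum_subtractf sum_distrib_left mult.assoc)
    \<comment> \<open>With upper limit \<open>T = M\<close>, the right-hand side of
      \<open>partial\<close> contains \<open>1 - q ^ 0 = 0\<close>, so the telescoped sum vanishes
      and the recurrence has no boundary term.\<close>
    show ?thesis
      using partial[of "Suc M" "Suc M"] unfolding S linear by simp
  qed
  have "(\<Sum>t\<le>M. f t * u (M - t)) = u M * v M * (\<Prod>i<M. 1 + a * c * q ^ Suc i)"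
  proof (induction M)
    case 0
    then show ?case by (simp add: f_def u0 numeral_2_eq_2)
  next
    case (Suc M)
    have "(1 - q ^ Suc M) * (1 - c\<^sup>2 * q ^ Suc M) * (\<Sum>t\<le>Suc M. f t * u (Suc M - t)) =
       (1 + a * c * q ^ Suc M) * ((u (Suc M) * (1 - q ^ Suc M)) * (v (Suc M) * (1 - c\<^sup>2 * q ^ Suc M)) * (\<Prod>i<M. 1 + a * c * q ^ Suc i))"
      unfolding rec Suc u v ..
    also have "\<dots> = (1 - q ^ Suc M) * (1 - c\<^sup>2 * q ^ Suc M) *
        (u (Suc M) * v (Suc M) * (\<Prod>i<Suc M. 1 + a * c * q ^ Suc i))"
      by (simp only: prod.lessThan_Suc mult_ac)
    finally show ?case
      using nz[of M] by (simp del: sum.atMost_Suc prod.lessThan_Suc power_Suc)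
  qed
  then show ?thesis by (simp add: f_def)
qed

definition qfact_inv :: "nat \<Rightarrow> 'a::field fps" where
  "qfact_inv n = inverse (qpoch fps_X n)"

lemma qpoch_Suc: "qpoch x (Suc n) = qpoch x n * (1 - x * fps_X ^ n)"
  by (simp add: qpoch_def)

lemma qfact_inv_0: "qfact_inv 0 = 1"
  by (simp add: qfact_inv_def qpoch_def)

lemma inverse_mult_fps:
  fixes F G :: "'a::field fps"
  assumes "fps_nth G 0 \<noteq> 0"
  shows "inverse (F * G) * G = inverse F"
  using assms by (simp add: fps_inverse_mult mult.assoc inverse_mult_eq_1)

lemma qfact_inv_Suc: "qfact_inv (Suc n) * (1 - fps_X ^ Suc n) = qfact_inv n"
  unfolding qfact_inv_def qpoch_Suc by (subst inverse_mult_fps[symmetric, of "1 - fps_X ^ Suc n"]) simp_all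

lemma fps_X_power_neq_1: "(fps_X :: 'a::field fps) ^ Suc n \<noteq> 1"
  by (auto dest: arg_cong[of _ _ "\<lambda>f. fps_nth f 0"])

text \<open>The shift \<open>s = t + r\<close> reduces this to \<open>q_Vandermonde\<close> with
  \<open>c = fps_X ^ r\<close> and \<open>v t = qfact_inv (t + 2 * r)\<close>. It evaluates the
  inner sum of the Bailey transform, that is, it supplies a conjugate Bailey pair relative to
  1.\<close>

lemma q_Vandermonde_fps:
  fixes a :: "'a::field fps"
  assumes "r \<le> n"
  shows "(\<Sum>s=r..n. (\<Prod>i<s. a + fps_X ^ i) * fps_X ^ (Suc s choose 2) * qfact_inv (n - s) * qfact_inv (s - r) * qfact_inv (s + r))
    = (\<Prod>i<r. a + fps_X ^ i) * fps_X ^ (Suc r choose 2) * qfact_inv (n - r) * qfact_inv (n + r)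
       * (\<Prod>i\<in>{r<..n}. 1 + a * fps_X ^ i)"
proof -
  define M where "M = n - r"
  have n: "n = M + r" using assms by (simp add: M_def)
  have ch: "Suc (t + r) choose 2 = (Suc r choose 2) + (Suc t choose 2) + r * t" for t
    by (induction t) (simp_all add: numeral_2_eq_2 algebra_simps)
  have pr: "(\<Prod>i<t + r. a + fps_X ^ i) = (\<Prod>i<r. a + fps_X ^ i) * (\<Prod>i<t. a + fps_X ^ r * fps_X ^ i)" for t
    by (induction t) (simp_all add: power_add mult_ac)
  have pr': "(\<Prod>i\<in>{r<..M + r}. 1 + a * fps_X ^ i) = (\<Prod>i<M. 1 + a * fps_X ^ r * fps_X ^ Suc i)"
    by (rule prod.reindex_bij_witness[of _ "\<lambda>i. Suc (i + r)" "\<lambda>i. i - Suc r"])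
       (auto simp: power_add[symmetric] mult.assoc simp flip: power_Suc)
  have V: "(\<Sum>t\<le>M. (\<Prod>i<t. a + fps_X ^ r * fps_X ^ i) * fps_X ^ (Suc t choose 2) * (fps_X ^ r) ^ t
        * qfact_inv t * qfact_inv (t + 2 * r) * qfact_inv (M - t))
    = qfact_inv M * qfact_inv (M + 2 * r) * (\<Prod>i<M. 1 + a * fps_X ^ r * fps_X ^ Suc i)"
  proof (rule q_Vandermonde)
    have e: "(fps_X ^ r)\<^sup>2 * fps_X ^ Suc n = (fps_X ^ Suc (n + 2 * r) :: 'a fps)" for n
      by (simp add: power_add power_mult mult_ac flip: power_mult)
    show "qfact_inv (Suc n + 2 * r) * (1 - (fps_X ^ r)\<^sup>2 * fps_X ^ Suc n) = (qfact_inv (n + 2 * r) :: 'a fps)" for n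
      unfolding e by (simp add: qfact_inv_Suc del: power_Suc)
    show "(fps_X ^ r)\<^sup>2 * fps_X ^ Suc n \<noteq> (1 :: 'a fps)" for n
      unfolding e by (rule fps_X_power_neq_1)
  qed (rule qfact_inv_0 qfact_inv_Suc fps_X_power_neq_1)+
  have "(\<Sum>s=r..n. (\<Prod>i<s. a + fps_X ^ i) * fps_X ^ (Suc s choose 2) * qfact_inv (n - s) * qfact_inv (s - r) * qfact_inv (s + r))
    = (\<Sum>t\<le>M. (\<Prod>i<t + r. a + fps_X ^ i) * fps_X ^ (Suc (t + r) choose 2) * qfact_inv (M - t) * qfact_inv t * qfact_inv (t + 2 * r))"
    by (rule sum.reindex_bij_witness[of _ "\<lambda>t. t + r" "\<lambda>s. s - r"]) (auto simp: n add.commute)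
  also have "\<dots> = (\<Prod>i<r. a + fps_X ^ i) * fps_X ^ (Suc r choose 2) *
      (\<Sum>t\<le>M. (\<Prod>i<t. a + fps_X ^ r * fps_X ^ i) * fps_X ^ (Suc t choose 2) * (fps_X ^ r) ^ t
        * qfact_inv t * qfact_inv (t + 2 * r) * qfact_inv (M - t))"
    unfolding sum_distrib_left by (intro sum.cong refl) (simp only: ch pr power_add power_mult[symmetric] mult_ac)
  also note V
  finally show ?thesis
    by (simp only: n pr' mult_2 mult_2_right add.assoc add_diff_cancel_right' mult_ac)
qed

text \<open>Substitute for \<beta> and exchange the two finite sums: the sum over \<open>s\<close>
  is then \<open>q_Vandermonde_fps\<close>. Starting the sums at 1 encodes that \<alpha> vanishes at
  0.\<close>

lemma Bailey_lemma:
  fixes a :: "'a::field fps"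
  assumes "\<And>n. \<beta> n = (\<Sum>r=1..n. \<alpha> r * qfact_inv (n - r) * qfact_inv (n + r))"
  shows "(\<Sum>s=1..n. (\<Prod>i<s. a + fps_X ^ i) * fps_X ^ (Suc s choose 2) * qfact_inv (n - s) * \<beta> s)
    = (\<Sum>r=1..n. (\<Prod>i<r. a + fps_X ^ i) * fps_X ^ (Suc r choose 2) * \<alpha> r * qfact_inv (n - r) * qfact_inv (n + r)
       * (\<Prod>i\<in>{r<..n}. 1 + a * fps_X ^ i))"
proof -
  let ?f = "\<lambda>s r. \<alpha> r * ((\<Prod>i<s. a + fps_X ^ i) * fps_X ^ (Suc s choose 2) * qfact_inv (n - s) * qfact_inv (s - r) * qfact_inv (s + r))"
  have "(\<Sum>s=1..n. (\<Prod>i<s. a + fps_X ^ i) * fps_X ^ (Suc s choose 2) * qfact_inv (n - s) * \<beta> s)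
     = (\<Sum>s=1..n. \<Sum>r=1..s. ?f s r)"
    unfolding assms sum_distrib_left by (intro sum.cong refl) (simp only: mult_ac)
  also have "\<dots> = (\<Sum>r=1..n. \<Sum>s=r..n. ?f s r)"
    unfolding sum.Sigma[OF finite_atLeastAtMost ballI[OF finite_atLeastAtMost]]
    by (rule sum.reindex_bij_witness[of _ "\<lambda>(r, s). (s, r)" "\<lambda>(s, r). (r, s)"]) auto
  also have "\<dots> = (\<Sum>r=1..n. (\<Prod>i<r. a + fps_X ^ i) * fps_X ^ (Suc r choose 2) * \<alpha> r * qfact_inv (n - r) * qfact_inv (n + r)
       * (\<Prod>i\<in>{r<..n}. 1 + a * fps_X ^ i))"
    unfolding sum_distrib_left[symmetric]
    by (intro sum.cong refl, subst q_Vandermonde_fps) (simp_all only: mult_ac atLeastAtMost_iff)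
  finally show ?thesis .
qed

lemma prod_fps_X_power: "(\<Prod>i<n. fps_X ^ i) = fps_X ^ (n choose 2)"
  by (induction n) (simp_all add: numeral_2_eq_2 power_add mult_ac)

lemma square_eq_choose_2: "n\<^sup>2 = (n choose 2) + (Suc n choose 2)"
  by (induction n) (simp_all add: numeral_2_eq_2 power2_eq_square)

text \<open>At \<open>a = 0\<close> the product of the \<open>fps_X ^ i\<close> contributes the
  exponent \<open>s choose 2\<close>, which completes \<open>Suc s choose 2\<close> to the square of
  \<open>s\<close>, and the last product in \<open>Bailey_lemma\<close> becomes 1. The result is
  again a Bailey pair, so the step can be repeated.\<close>

lemma Bailey_lemma_iterate:
  fixes \<alpha> \<beta> :: "nat \<Rightarrow> 'a::field fps"
  assumes "\<And>n. \<beta> n = (\<Sum>r=1..n. \<alpha> r * qfact_inv (n - r) * qfact_inv (n + r))"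
  shows "((\<lambda>g n. \<Sum>s=1..n. fps_X ^ s\<^sup>2 * qfact_inv (n - s) * g s) ^^ j) \<beta> n
    = (\<Sum>r=1..n. fps_X ^ (j * r\<^sup>2) * \<alpha> r * qfact_inv (n - r) * qfact_inv (n + r))"
proof (induction j arbitrary: n)
  case 0
  then show ?case by (simp add: assms)
next
  case (Suc j)
  show ?case
    using Bailey_lemma[of _ "\<lambda>r. fps_X ^ (j * r\<^sup>2) * \<alpha> r" 0 n, OF Suc]
    by (simp add: prod_fps_X_power power_add square_eq_choose_2 mult_ac)
qed

subsection \<open>A Bailey pair\<close>

definition Bailey_numerator :: "nat \<Rightarrow> 'a::field fps" where
  "Bailey_numerator r = (-1) ^ (r - 1) * fps_X ^ (r choose 2) * (1 - fps_X ^ r) * (1 - fps_X ^ (2 * r))"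

lemma Bailey_numerator_Suc:
  "Bailey_numerator (Suc r) = (-1) ^ r * fps_X ^ (r choose 2) * fps_X ^ r * (1 - fps_X ^ Suc r) * (1 - (fps_X ^ Suc r)\<^sup>2)"
  by (simp add: Bailey_numerator_def numeral_2_eq_2 power_add mult_ac)

text \<open>The closed form comes from \<open>q\<close>-Gosper summation.\<close>

lemma Bailey_numerator_partial_sum:
  assumes "R \<le> m"
  shows "(1 - fps_X ^ m) * (\<Sum>r=1..R. fps_X ^ (Suc m - r) * Bailey_numerator r * qfact_inv (Suc m - r) * qfact_inv (Suc m + r))
    = - ((-1) ^ R * fps_X ^ (R choose 2) * fps_X ^ m * (1 - fps_X ^ R) * (1 - fps_X ^ Suc R) * qfact_inv (m - R) * (qfact_inv (Suc m + R) :: 'a::field fps))"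
  using assms
proof (induction R)
  case 0
  then show ?case by simp
next
  case (Suc R)
  define N where "N = m - Suc R"
  have m: "m = N + Suc R" using Suc.prems by (simp add: N_def)
  \<comment> \<open>Treating these powers as independent variables makes the induction step a
    polynomial identity, which \<open>algebra\<close> decides.\<close>
  define x y :: "'a fps" where "x = fps_X ^ R" and "y = fps_X ^ N"
  have u1: "qfact_inv N = qfact_inv (Suc N) * (1 - y * fps_X :: 'a fps)"
    using qfact_inv_Suc[of N, symmetric] by (simp add: y_def mult_ac)
  have u2: "qfact_inv (Suc m + R) = qfact_inv (Suc m + Suc R) * (1 - y * x\<^sup>2 * fps_X ^ 3 :: 'a fps)"
    using qfact_inv_Suc[of "Suc m + R", symmetric]
    by (simp add: x_def y_def m power_add mult_ac power2_eq_square eval_nat_numeral)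
  have X: "fps_X ^ m = y * x * (fps_X :: 'a fps)" "fps_X ^ Suc N = y * (fps_X :: 'a fps)"
    "fps_X ^ Suc (Suc R) = x * (fps_X :: 'a fps)\<^sup>2" "fps_X ^ Suc R = x * (fps_X :: 'a fps)" "fps_X ^ R = x"
    by (simp_all add: m x_def y_def power_add power2_eq_square mult_ac)
  have ch: "Suc R choose 2 = (R choose 2) + R" by (simp add: numeral_2_eq_2)
  have peel: "(\<Sum>r=1..Suc n. f r) = (\<Sum>r=1..n. f r) + f (Suc n)" for f :: "nat \<Rightarrow> 'a fps" and n
    by simp
  have nat: "Suc m - Suc R = Suc N" "m - R = Suc N" "m - Suc R = N" by (simp_all add: m)
  show ?case
    unfolding peel distrib_left Suc.IH[OF Suc_leD[OF Suc.prems]]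
    unfolding Bailey_numerator_Suc nat ch power_add X u1 u2 power_Suc[of "-1"]
    by algebra
qed

text \<open>The term \<open>r = Suc m\<close> cancels the partial sum up to \<open>m\<close>. That
  sum is known only after multiplication by \<open>1 - fps_X ^ m\<close>, which is zero at
  \<open>m = 0\<close>; there the single remaining term is computed directly.\<close>

lemma Bailey_numerator_sum:
  "(\<Sum>r=1..Suc m. fps_X ^ (Suc m - r) * Bailey_numerator r * qfact_inv (Suc m - r) * qfact_inv (Suc m + r))
    = (if m = 0 then 1 else 0 :: 'a::field fps)" (is "?S = _")
proof (cases m)
  case 0
  have "qfact_inv 2 * ((1 - fps_X) * (1 - fps_X\<^sup>2)) = (qfact_inv 0 :: 'a fps)"
    unfolding qfact_inv_Suc[of 0, symmetric] using qfact_inv_Suc[of 1]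
    by (simp add: numeral_2_eq_2 mult_ac)
  then show ?thesis
    using 0 by (simp add: Bailey_numerator_def qfact_inv_0 numeral_2_eq_2 mult_ac)
next
  case (Suc m')
  have u: "qfact_inv (Suc m + m) = qfact_inv (Suc m + Suc m) * (1 - (fps_X ^ Suc m)\<^sup>2 :: 'a fps)"
    using qfact_inv_Suc[of "Suc m + m", symmetric] by (simp add: power2_eq_square power_add mult_ac)
  have peel: "(\<Sum>r=1..Suc n. f r) = (\<Sum>r=1..n. f r) + f (Suc n)" for f :: "nat \<Rightarrow> 'a fps" and n
    by simp
  have "(1 - fps_X ^ m) * ?S = 0"
    unfolding peel distrib_left Bailey_numerator_partial_sum[OF order_refl]
    unfolding Bailey_numerator_Suc u by (simp add: qfact_inv_0 mult_ac)
  then show ?thesis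
    using fps_X_power_neq_1[of m'] Suc by auto
qed

text \<open>This is the denominator of the two-sided geometric series in \<open>z\<close>, and also
  the quotient of consecutive values of \<open>Bailey_beta\<close> from index 1 on.\<close>

definition rank_factor :: "'a::field fps \<Rightarrow> nat \<Rightarrow> 'a fps" where
  "rank_factor z n = (1 - z * fps_X ^ n) * (1 - inverse z * fps_X ^ n)"

lemma rank_factor_nth_0: "n > 0 \<Longrightarrow> fps_nth (rank_factor z n) 0 = 1"
  by (simp add: rank_factor_def)

text \<open>
  The first summand cancels the denominator of \<open>\<alpha> r\<close>, so that it no longer depends on \<open>z\<close>;
  the second one lowers \<open>n\<close> in the Bailey kernel.
\<close>

lemma rank_factor_eq:
  fixes z :: "'a::field fps"
  assumes "fps_nth z 0 \<noteq> 0" and "r \<le> n"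
  shows "rank_factor z n = fps_X ^ (n - r) * rank_factor z r + (1 - fps_X ^ (n - r)) * (1 - fps_X ^ (n + r))"
proof -
  define d where "d = n - r"
  have n: "n = d + r" using assms by (simp add: d_def)
  define w x y :: "'a fps" where "w = inverse z" and "x = fps_X ^ r" and "y = fps_X ^ d"
  have "z * w = 1" using assms by (simp add: w_def inverse_mult_eq_1')
  then have "(1 - z * (y * x)) * (1 - w * (y * x)) = y * ((1 - z * x) * (1 - w * x)) + (1 - y) * (1 - y * x * x)"
    by algebra
  then show ?thesis
    by (simp add: rank_factor_def n power_add w_def x_def y_def)
qed

definition Bailey_alpha :: "'a::field fps \<Rightarrow> nat \<Rightarrow> 'a fps" where
  "Bailey_alpha z r = Bailey_numerator r * inverse (rank_factor z r)"

text \<open>The empty products would give 1 at index 0; the value 0 is forced by the Bailey pair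
  sum, which is empty there.\<close>

definition Bailey_beta :: "'a::field fps \<Rightarrow> nat \<Rightarrow> 'a fps" where
  "Bailey_beta z n = (if n = 0 then 0 else inverse (qpoch (z * fps_X) n * qpoch (inverse z * fps_X) n))"

text \<open>Multiplying by \<open>rank_factor z n\<close> splits the sum by
  \<open>rank_factor_eq\<close> into a \<open>z\<close>-free sum and the same sum for
  \<open>n - 1\<close>. \<open>Bailey_beta\<close> satisfies the same first-order
  recurrence.\<close>

theorem Bailey_pair:
  assumes z: "fps_nth z 0 \<noteq> 0"
  shows "Bailey_beta z n = (\<Sum>r=1..n. Bailey_alpha z r * qfact_inv (n - r) * qfact_inv (n + r))"
proof (induction n)
  case 0
  then show ?case by (simp add: Bailey_beta_def)
next
  case (Suc m)
  let ?n = "Suc m" and ?T = "\<lambda>n r. Bailey_alpha z r * qfact_inv (n - r) * qfact_inv (n + r)"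
  have alpha: "Bailey_alpha z r * rank_factor z r = Bailey_numerator r" if "r > 0" for r
    using that by (simp add: Bailey_alpha_def mult.assoc inverse_mult_eq_1 rank_factor_nth_0)
  have "rank_factor z ?n * ?T ?n r =
      fps_X ^ (?n - r) * Bailey_numerator r * qfact_inv (?n - r) * qfact_inv (?n + r)
      + (if r \<le> m then ?T m r else 0)" if r: "r \<in> {1..?n}" for r
  proof -
    have "rank_factor z ?n * ?T ?n r =
      fps_X ^ (?n - r) * (Bailey_alpha z r * rank_factor z r) * qfact_inv (?n - r) * qfact_inv (?n + r)
      + Bailey_alpha z r * (qfact_inv (?n - r) * (1 - fps_X ^ (?n - r))) * (qfact_inv (?n + r) * (1 - fps_X ^ (?n + r)))"
      unfolding rank_factor_eq[OF z, of r ?n, OF r[THEN atLeastAtMost_iff[THEN iffD1], THEN conjunct2]]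
      by (simp add: algebra_simps)
    also have "qfact_inv (?n + r) * (1 - fps_X ^ (?n + r)) = (qfact_inv (m + r) :: 'a fps)"
      using qfact_inv_Suc[of "m + r"] by simp
    \<comment> \<open>For the top index \<open>r = Suc m\<close> the factor
      \<open>1 - fps_X ^ 0\<close> kills the second summand.\<close>
    also have "qfact_inv (?n - r) * (1 - fps_X ^ (?n - r)) = (if r \<le> m then qfact_inv (m - r) else 0 :: 'a fps)"
      using qfact_inv_Suc[of "m - r"] r by (auto simp: Suc_diff_le not_le)
    finally show ?thesis using r by (simp add: alpha)
  qed
  then have "rank_factor z ?n * (\<Sum>r=1..?n. ?T ?n r) =
      (\<Sum>r=1..?n. fps_X ^ (?n - r) * Bailey_numerator r * qfact_inv (?n - r) * qfact_inv (?n + r))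
      + (\<Sum>r=1..?n. if r \<le> m then ?T m r else 0)"
    unfolding sum_distrib_left sum.distrib[symmetric] by (intro sum.cong refl)
  also have "(\<Sum>r=1..?n. if r \<le> m then ?T m r else 0) = (\<Sum>r=1..m. ?T m r)"
    by (simp add: sum.cl_ivl_Suc)
  also note Suc[symmetric]
  also note Bailey_numerator_sum
  \<comment> \<open>The extra 1 at \<open>m = 0\<close> makes up for \<open>Bailey_beta z 0\<close>
    being 0 instead of 1.\<close>
  also have "(if m = 0 then 1 else 0) + Bailey_beta z m = Bailey_beta z ?n * rank_factor z ?n"
  proof -
    have "inverse (qpoch (z * fps_X) m * qpoch (inverse z * fps_X) m)
        = inverse (qpoch (z * fps_X) ?n * qpoch (inverse z * fps_X) ?n) * rank_factor z ?n"
      by (subst inverse_mult_fps[of "rank_factor z ?n", symmetric])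
         (simp_all add: rank_factor_nth_0 qpoch_Suc rank_factor_def mult_ac)
    then show ?thesis by (auto simp: Bailey_beta_def qpoch_def)
  qed
  finally have "rank_factor z ?n * (\<Sum>r=1..?n. ?T ?n r) = rank_factor z ?n * Bailey_beta z ?n"
    by (simp add: mult.commute)
  moreover have "rank_factor z ?n \<noteq> 0"
    using rank_factor_nth_0[of ?n z] by auto
  ultimately show ?case by simp
qed

subsection \<open>Congruences modulo powers of the indeterminate\<close>

lemma fps_X_power_dvd_iff: "fps_X ^ n dvd F \<longleftrightarrow> (\<forall>i<n. fps_nth F i = 0)"
  for F :: "'a::field fps"
proof
  assume "\<forall>i<n. fps_nth F i = 0"
  then have "fps_cutoff n F = 0" by (simp add: fps_eq_iff)
  then have "F = fps_X ^ n * fps_shift n F" using fps_shift_cutoff'[of n F] by simp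
  then show "fps_X ^ n dvd F" by (rule dvdI)
qed (auto simp: fps_X_power_mult_nth elim!: dvdE)

lemma fps_X_power_Suc_dvd_diffD:
  fixes F G :: "'a::field fps"
  assumes "fps_X ^ Suc n dvd F - G"
  shows "fps_nth F n = fps_nth G n"
  using assms unfolding fps_X_power_dvd_iff by simp

lemma dvd_diff_mult_cong:
  fixes d :: "'a::comm_ring_1"
  assumes "d dvd a - b" "d dvd a' - b'"
  shows "d dvd a * a' - b * b'"
proof -
  have "a * a' - b * b' = (a - b) * a' + b * (a' - b')" by (simp add: algebra_simps)
  with assms show ?thesis by simp
qed

lemma dvd_diff_inverse_cong:
  fixes F G :: "'a::field fps"
  assumes "d dvd F - G" "fps_nth F 0 \<noteq> 0" "fps_nth G 0 \<noteq> 0"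
  shows "d dvd inverse F - inverse G"
proof -
  define f g where "f = inverse F" and "g = inverse G"
  have "F * f = 1" "G * g = 1" using assms by (simp_all add: f_def g_def inverse_mult_eq_1')
  then have "f - g = (F - G) * (- f * g)" by algebra
  then have "d dvd f - g" using assms(1) by simp
  then show ?thesis by (simp add: f_def g_def)
qed

text \<open>Consecutive reciprocals differ by \<open>fps_X ^ Suc i * qfact_inv (Suc i)\<close>, so
  the differences from index \<open>j\<close> on all have order above \<open>j\<close>.\<close>

lemma fps_X_power_dvd_qfact_inv_diff:
  assumes "j \<le> i"
  shows "fps_X ^ Suc j dvd qfact_inv i - (qfact_inv j :: 'a::field fps)"
  using assms
proof (induction i rule: dec_induct)
  case (step i)
  have "qfact_inv (Suc i) - qfact_inv i = fps_X ^ Suc i * (qfact_inv (Suc i) :: 'a fps)"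
    using qfact_inv_Suc[of i, where 'a='a] by (simp add: algebra_simps)
  moreover have "(fps_X :: 'a fps) ^ Suc j dvd fps_X ^ Suc i" using step by (simp add: le_imp_power_dvd)
  ultimately have "fps_X ^ Suc j dvd qfact_inv (Suc i) - (qfact_inv i :: 'a fps)" by simp
  from dvd_add[OF this step.IH] show ?case by simp
qed simp

text \<open>Since \<open>x\<close> is divisible by \<open>fps_X\<close>, the first omitted factor is
  already 1 modulo \<open>fps_X ^ Suc n\<close>; this gains one order over the number of
  factors.\<close>

lemma fps_X_power_dvd_qpoch_inf_diff:
  fixes x :: "'a::field fps"
  assumes x: "fps_nth x 0 = 0"
  shows "fps_X ^ Suc n dvd qpoch_inf x - qpoch x n"
proof -
  have "fps_X ^ 1 dvd x" unfolding fps_X_power_dvd_iff using x by simp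
  then obtain y where y: "x = fps_X * y" by (auto elim: dvdE)
  have "qpoch x (Suc n) - qpoch x n = fps_X ^ Suc n * (- y * qpoch x n)"
    by (simp add: qpoch_Suc y algebra_simps)
  then have "fps_X ^ Suc n dvd qpoch x (Suc n) - qpoch x n" by simp
  moreover have "fps_X ^ Suc n dvd qpoch_inf x - qpoch x (Suc n)"
    unfolding fps_X_power_dvd_iff
    by (auto simp: has_prod_qpoch_inf(2)[OF x] less_Suc_eq_le qpoch_nth_stable[of _ "Suc n"])
  ultimately show ?thesis using dvd_add by fastforce
qed

text \<open>The weight \<open>h\<close> bounds the order in \<open>q\<close> from below, so
  coefficient \<open>n\<close> sees only the finitely many indices of weight at most
  \<open>n\<close>.\<close>

lemma fps_has_sum_fibres:
  fixes f :: "'b \<Rightarrow> 'a::comm_ring_1 fps" and h :: "'b \<Rightarrow> nat"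
  assumes fin: "\<And>m. finite {x \<in> A. h x = m}"
    and f: "\<And>x n. x \<in> A \<Longrightarrow> n < h x \<Longrightarrow> fps_nth (f x) n = 0"
    and S: "\<And>n. fps_nth S n = fps_nth (\<Sum>m\<le>n. \<Sum>x | x \<in> A \<and> h x = m. f x) n"
  shows "(f has_sum S) A"
proof (rule fps_has_sumI)
  fix n
  let ?B = "\<lambda>m. {x \<in> A. h x = m}"
  have sub: "{x \<in> A. fps_nth (f x) n \<noteq> 0} \<subseteq> (\<Union>m\<le>n. ?B m)"
    using f by (fastforce simp: not_less[symmetric])
  moreover have fin': "finite (\<Union>m\<le>n. ?B m)" using fin by auto
  ultimately show "finite {x \<in> A. fps_nth (f x) n \<noteq> 0}" by (rule finite_subset)
  have "(\<Sum>x | x \<in> A \<and> fps_nth (f x) n \<noteq> 0. fps_nth (f x) n) = (\<Sum>x\<in>(\<Union>m\<le>n. ?B m). fps_nth (f x) n)"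
    using sub fin' by (intro sum.mono_neutral_left) auto
  also have "\<dots> = (\<Sum>m\<le>n. \<Sum>x\<in>?B m. fps_nth (f x) n)"
    using fin by (intro sum.UNION_disjoint) auto
  finally show "fps_nth S n = (\<Sum>x | x \<in> A \<and> fps_nth (f x) n \<noteq> 0. fps_nth (f x) n)"
    by (simp add: S fps_sum_nth)
qed

lemma choose_2_ge: "n \<le> Suc n choose 2"
  by (induction n) (simp_all add: numeral_2_eq_2)

text \<open>In \<open>Bailey_lemma\<close> at level \<open>N\<close> every
  \<open>qfact_inv (N - s)\<close> and \<open>qfact_inv (N + r)\<close> may be replaced by
  \<open>qfact_inv N\<close>; the common factor \<open>qfact_inv N\<close> is then cancelled, being
  a unit.\<close>

lemma Bailey_lemma_limit:
  fixes a :: "'a::field fps"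
  assumes "\<And>n. \<beta> n = (\<Sum>r=1..n. \<alpha> r * qfact_inv (n - r) * qfact_inv (n + r))"
  shows "fps_X ^ Suc N dvd
    (\<Sum>s=1..N. (\<Prod>i<s. a + fps_X ^ i) * fps_X ^ (Suc s choose 2) * \<beta> s)
    - qpoch (- a * fps_X) N * qfact_inv N *
      (\<Sum>r=1..N. (\<Prod>i<r. a + fps_X ^ i) * fps_X ^ (Suc r choose 2) * \<alpha> r * inverse (qpoch (- a * fps_X) r))"
    (is "_ dvd ?S - ?Q * ?u * ?R")
proof -
  \<comment> \<open>The difference of reciprocals has order only \<open>Suc (N - s)\<close>; the
    missing \<open>s\<close> powers come from the exponent \<open>Suc s choose 2\<close>, which is
    at least \<open>s\<close>.\<close>
  have shift: "fps_X ^ Suc N dvd p * fps_X ^ (Suc s choose 2) * (qfact_inv (N - s) - qfact_inv N)"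
    if "s \<le> N" for s and p :: "'a fps"
  proof -
    have "fps_X ^ (s + Suc (N - s)) dvd fps_X ^ (Suc s choose 2) * (qfact_inv (N - s) - qfact_inv N :: 'a fps)"
      unfolding power_add
      by (intro mult_dvd_mono le_imp_power_dvd choose_2_ge)
         (use fps_X_power_dvd_qfact_inv_diff[of "N - s" N] in \<open>simp add: dvd_diff_commute\<close>)
    then show ?thesis using that by (simp add: mult.assoc)
  qed
  have qpoch: "(\<Prod>i\<in>{r<..N}. 1 + a * fps_X ^ i) = ?Q * inverse (qpoch (- a * fps_X) r)" if "r \<le> N" for r
  proof -
    have "?Q = (\<Prod>i\<in>{r<..N}. 1 + a * fps_X ^ i) * qpoch (- a * fps_X) r"
      using that
    proof (induction N rule: dec_induct)
      case (step n)
      then have "{r<..Suc n} = insert (Suc n) {r<..n}" by auto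
      with step show ?case by (simp add: qpoch_Suc mult_ac)
    qed simp
    then show ?thesis
      by (simp add: mult.assoc inverse_mult_eq_1' qpoch_nth_0)
  qed
  define c where "c s = (\<Prod>i<s. a + fps_X ^ i) * fps_X ^ (Suc s choose 2)" for s
  have L: "fps_X ^ Suc N dvd (\<Sum>s=1..N. c s * qfact_inv (N - s) * \<beta> s) - ?u * ?S"
    unfolding c_def sum_distrib_left sum_subtractf[symmetric]
  proof (rule dvd_sum)
    fix s assume "s \<in> {1..N}"
    then show "fps_X ^ Suc N dvd (\<Prod>i<s. a + fps_X ^ i) * fps_X ^ (Suc s choose 2) * qfact_inv (N - s) * \<beta> s
      - ?u * ((\<Prod>i<s. a + fps_X ^ i) * fps_X ^ (Suc s choose 2) * \<beta> s)"
      using shift[of s "\<beta> s * (\<Prod>i<s. a + fps_X ^ i)"] by (simp add: algebra_simps)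
  qed
  have R: "fps_X ^ Suc N dvd (\<Sum>r=1..N. c r * \<alpha> r * qfact_inv (N - r) * qfact_inv (N + r) * (\<Prod>i\<in>{r<..N}. 1 + a * fps_X ^ i))
     - ?u * (?Q * ?u * ?R)"
    unfolding c_def sum_distrib_left sum_subtractf[symmetric]
  proof (rule dvd_sum)
    fix r assume r: "r \<in> {1..N}"
    define p where "p = \<alpha> r * (\<Prod>i<r. a + fps_X ^ i) * ?Q * inverse (qpoch (- a * fps_X) r)"
    have "fps_X ^ Suc N dvd p * fps_X ^ (Suc r choose 2) * qfact_inv (N - r) * qfact_inv (N + r) -
        p * fps_X ^ (Suc r choose 2) * ?u * ?u"
      using r shift[of r p] fps_X_power_dvd_qfact_inv_diff[of N "N + r"]
      by - (rule dvd_diff_mult_cong, simp_all add: right_diff_distrib)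
    also have "p * fps_X ^ (Suc r choose 2) * qfact_inv (N - r) * qfact_inv (N + r) =
       (\<Prod>i<r. a + fps_X ^ i) * fps_X ^ (Suc r choose 2) * \<alpha> r * qfact_inv (N - r) * qfact_inv (N + r) * (\<Prod>i\<in>{r<..N}. 1 + a * fps_X ^ i)"
      using r by (simp only: p_def qpoch atLeastAtMost_iff mult_ac)
    also have "p * fps_X ^ (Suc r choose 2) * ?u * ?u =
       ?u * (?Q * ?u * ((\<Prod>i<r. a + fps_X ^ i) * fps_X ^ (Suc r choose 2) * \<alpha> r * inverse (qpoch (- a * fps_X) r)))"
      by (simp only: p_def mult_ac)
    finally show "fps_X ^ Suc N dvd (\<Prod>i<r. a + fps_X ^ i) * fps_X ^ (Suc r choose 2) * \<alpha> r * qfact_inv (N - r) * qfact_inv (N + r) * (\<Prod>i\<in>{r<..N}. 1 + a * fps_X ^ i) -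
       ?u * (?Q * ?u * ((\<Prod>i<r. a + fps_X ^ i) * fps_X ^ (Suc r choose 2) * \<alpha> r * inverse (qpoch (- a * fps_X) r)))" .
  qed
  have "fps_X ^ Suc N dvd ?u * ?S - ?u * (?Q * ?u * ?R)"
    using dvd_diff[OF R L] Bailey_lemma[OF assms, where a=a and n=N] by (simp add: c_def)
  then have "fps_X ^ Suc N dvd qpoch fps_X N * (?u * ?S - ?u * (?Q * ?u * ?R))"
    by (rule dvd_mult)
  also have "qpoch fps_X N * (?u * ?S - ?u * (?Q * ?u * ?R)) = (qpoch fps_X N * ?u) * (?S - ?Q * ?u * ?R)"
    by (simp add: algebra_simps)
  also have "qpoch fps_X N * ?u = 1"
    by (simp add: qfact_inv_def inverse_mult_eq_1' qpoch_nth_0)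
  finally show ?thesis by simp
qed

subsection \<open>Sums over descending tuples\<close>

text \<open>Tuples are extended at the end; \<open>r \<ge> 1\<close> keeps the appended position
  apart from position 1, so the first entry stays fixed.\<close>

lemma desc_tuples_Suc:
  assumes "r \<ge> 1"
  shows "{\<nu> \<in> desc_tuples (Suc r). \<nu> 1 = n} =
    (\<lambda>(\<nu>, m). \<nu>(Suc r := m)) ` (SIGMA \<nu>:{\<nu> \<in> desc_tuples r. \<nu> 1 = n}. {1..\<nu> r})" (is "?A = ?g ` ?B")
proof (intro equalityI subsetI)
  fix \<nu> assume \<nu>: "\<nu> \<in> ?A"
  \<comment> \<open>Extensional functions on \<open>{1..r}\<close> take the value
    \<open>undefined\<close> at \<open>Suc r\<close>, so truncating a tuple means resetting that
    position.\<close>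
  have "\<nu>(Suc r := undefined) \<in> {1..r} \<rightarrow>\<^sub>E {1..}"
    using \<nu> by (auto simp: desc_tuples_def PiE_def Pi_def extensional_def)
  moreover have "\<nu> i \<ge> \<nu> (Suc i)" if "i \<in> {1..r}" for i
    using \<nu> that by (auto simp: desc_tuples_def)
  moreover have "\<nu> (Suc r) \<ge> 1"
    using \<nu> by (auto simp: desc_tuples_def PiE_def Pi_def)
  ultimately have "(\<nu>(Suc r := undefined), \<nu> (Suc r)) \<in> ?B"
    using \<nu> assms by (auto simp: desc_tuples_def)
  then show "\<nu> \<in> ?g ` ?B" by (rule rev_image_eqI) simp
next
  fix \<nu> assume "\<nu> \<in> ?g ` ?B"
  then obtain \<mu> m where \<mu>: "\<mu> \<in> desc_tuples r" "\<mu> 1 = n" "m \<in> {1..\<mu> r}" "\<nu> = \<mu>(Suc r := m)" by auto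
  have "\<nu> \<in> {1..Suc r} \<rightarrow>\<^sub>E {1..}"
    using \<mu> by (auto simp: desc_tuples_def PiE_def Pi_def extensional_def)
  moreover have "\<nu> i \<ge> \<nu> (Suc i)" if "i \<in> {1..<Suc r}" for i
    using \<mu> that by (cases "i = r") (auto simp: desc_tuples_def)
  ultimately show "\<nu> \<in> ?A" using \<mu> assms by (auto simp: desc_tuples_def)
qed

lemma desc_tuples_1: "n \<ge> 1 \<Longrightarrow> {\<nu> \<in> desc_tuples 1. \<nu> 1 = n} = {\<lambda>i\<in>{1}. n}"
  by (auto simp: desc_tuples_def PiE_def Pi_def extensional_def)

lemma desc_tuples_eq_0: "r \<ge> 1 \<Longrightarrow> {\<nu> \<in> desc_tuples r. \<nu> 1 = 0} = {}"
  by (auto simp: desc_tuples_def PiE_def Pi_def)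

lemma finite_desc_tuples: "finite {\<nu> \<in> desc_tuples (Suc j). \<nu> 1 = n}"
proof (induction j)
  case 0
  show ?case
  proof (cases "n = 0")
    case True
    show ?thesis unfolding True One_nat_def[symmetric] desc_tuples_eq_0[OF order_refl] by simp
  next
    case False
    then have "n \<ge> 1" by simp
    then show ?thesis unfolding One_nat_def[symmetric] desc_tuples_1[OF \<open>n \<ge> 1\<close>] by simp
  qed
next
  case (Suc j)
  then show ?case by (subst desc_tuples_Suc) auto
qed

text \<open>Summing out the last entry of the tuple applies one step of the iteration to \<open>g\<close>.\<close>

lemma sum_desc_tuples:
  fixes g :: "nat \<Rightarrow> 'a::field fps"
  assumes n: "n \<ge> 1"
  shows "(\<Sum>\<nu> | \<nu> \<in> desc_tuples (Suc j) \<and> \<nu> 1 = n.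
      fps_X ^ (\<Sum>i=2..Suc j. (\<nu> i)\<^sup>2) * (\<Prod>i=1..<Suc j. qfact_inv (\<nu> i - \<nu> (Suc i))) * g (\<nu> (Suc j)))
    = ((\<lambda>g n. \<Sum>s=1..n. fps_X ^ s\<^sup>2 * qfact_inv (n - s) * g s) ^^ j) g n"
proof (induction j arbitrary: g)
  case 0
  then show ?case using desc_tuples_1[OF n] by simp
next
  case (Suc j)
  let ?r = "Suc j"
  let ?B = "SIGMA \<nu>:{\<nu> \<in> desc_tuples ?r. \<nu> 1 = n}. {1..\<nu> ?r}"
  let ?h = "\<lambda>(\<nu>, m). \<nu>(Suc ?r := m) :: nat \<Rightarrow> nat"
  let ?t = "\<lambda>j g \<nu>. fps_X ^ (\<Sum>i=2..Suc j. (\<nu> i)\<^sup>2) * (\<Prod>i=1..<Suc j. qfact_inv (\<nu> i - \<nu> (Suc i))) * g (\<nu> (Suc j)) :: 'a fps"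
  have inj: "inj_on ?h ?B"
  proof (rule inj_onI, clarify)
    fix \<mu> m \<mu>' m'
    assume mem: "\<mu> \<in> desc_tuples ?r" "\<mu>' \<in> desc_tuples ?r" and eq: "\<mu>(Suc ?r := m) = \<mu>'(Suc ?r := m')"
    \<comment> \<open>Both tuples are \<open>undefined\<close> at the overwritten position, so the
      update loses no information.\<close>
    have "\<mu> (Suc ?r) = \<mu>' (Suc ?r)" using mem by (auto simp: desc_tuples_def PiE_def extensional_def)
    then have "\<mu> = \<mu>'" using eq by (metis fun_upd_triv fun_upd_upd)
    moreover have "m = m'" using eq by (metis fun_upd_same)
    ultimately show "\<mu> = \<mu>' \<and> m = m'" by simp
  qed
  have image: "{\<nu> \<in> desc_tuples (Suc ?r). \<nu> 1 = n} = ?h ` ?B"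
    by (rule desc_tuples_Suc) simp
  have "(\<Sum>\<nu> | \<nu> \<in> desc_tuples (Suc ?r) \<and> \<nu> 1 = n. ?t ?r g \<nu>) = (\<Sum>x\<in>?B. ?t ?r g (?h x))"
    by (simp only: image sum.reindex[OF inj] o_def)
  also have "\<dots> = (\<Sum>(\<nu>, m)\<in>?B. fps_X ^ (\<Sum>i=2..?r. (\<nu> i)\<^sup>2) * (\<Prod>i=1..<?r. qfact_inv (\<nu> i - \<nu> (Suc i)))
       * (fps_X ^ m\<^sup>2 * qfact_inv (\<nu> ?r - m) * g m))"
  proof (intro sum.cong refl, clarify)
    fix \<nu> :: "nat \<Rightarrow> nat" and m
    have "(\<Sum>i=2..Suc ?r. ((\<nu>(Suc ?r := m)) i)\<^sup>2) = (\<Sum>i=2..?r. (\<nu> i)\<^sup>2) + m\<^sup>2"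
      by simp
    moreover have "(\<Prod>i=1..<Suc ?r. qfact_inv ((\<nu>(Suc ?r := m)) i - (\<nu>(Suc ?r := m)) (Suc i)))
        = (\<Prod>i=1..<?r. qfact_inv (\<nu> i - \<nu> (Suc i))) * (qfact_inv (\<nu> ?r - m) :: 'a fps)"
      by simp
    ultimately show "?t ?r g (\<nu>(Suc ?r := m)) = fps_X ^ (\<Sum>i=2..?r. (\<nu> i)\<^sup>2) * (\<Prod>i=1..<?r. qfact_inv (\<nu> i - \<nu> (Suc i)))
       * (fps_X ^ m\<^sup>2 * qfact_inv (\<nu> ?r - m) * g m)"
      by (simp only: power_add mult_ac fun_upd_same)
  qed
  also have "\<dots> = (\<Sum>\<nu> | \<nu> \<in> desc_tuples ?r \<and> \<nu> 1 = n. ?t j (\<lambda>n. \<Sum>s=1..n. fps_X ^ s\<^sup>2 * qfact_inv (n - s) * g s) \<nu>)"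
    by (subst sum.Sigma[symmetric]) (simp_all add: finite_desc_tuples[simplified] sum_distrib_left)
  also note Suc
  \<comment> \<open>The new step acts on \<open>g\<close> before the others, which is why the
    induction leaves \<open>g\<close> arbitrary and the power is unfolded on the right.\<close>
  finally show ?case by (simp only: funpow_Suc_right o_apply)
qed

subsection \<open>Truncated series\<close>

text \<open>The multisum enters through the single sum of \<open>Bailey_lemma_limit\<close>, after
  \<open>k - 2\<close> Bailey steps at \<open>a = 0\<close>. Only coefficient \<open>N\<close> of
  the truncation at \<open>N\<close> goes into the final series.\<close>

definition multisum_trunc :: "'a::field fps \<Rightarrow> 'a fps \<Rightarrow> nat \<Rightarrow> nat \<Rightarrow> 'a fps" where
  "multisum_trunc a z k N = qpoch (- a * fps_X) N * qfact_inv N *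
    (\<Sum>n=1..N. (\<Prod>i<n. a + fps_X ^ i) * fps_X ^ (Suc n choose 2) * (fps_X ^ ((k - 2) * n\<^sup>2) * Bailey_alpha z n)
       * inverse (qpoch (- a * fps_X) n))"

lemma multisum_term_eq:
  fixes c :: "'a::field"
  assumes "c \<noteq> 0" and "k \<ge> 2" and \<nu>: "\<nu> \<in> desc_tuples (k - 1)"
  shows "multisum_term (fps_const c) z k \<nu> =
    (\<Prod>i<\<nu> 1. fps_const c + fps_X ^ i) * fps_X ^ (Suc (\<nu> 1) choose 2) *
      (fps_X ^ (\<Sum>i=2..k-1. (\<nu> i)\<^sup>2) * (\<Prod>i=1..<k-1. qfact_inv (\<nu> i - \<nu> (Suc i))) * Bailey_beta z (\<nu> (k - 1)))"
proof -
  have "k - 1 \<in> {1..k-1}" using \<open>k \<ge> 2\<close> by simp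
  moreover have "\<nu> \<in> {1..k-1} \<rightarrow>\<^sub>E {1..}" using \<nu> by (simp add: desc_tuples_def)
  ultimately have "\<nu> (k - 1) \<in> {1..}" by (blast dest: PiE_mem)
  then have pos: "\<nu> (k - 1) \<noteq> 0" by simp
  define P where "P = (\<Prod>i=1..<k-1. qpoch fps_X (\<nu> i - \<nu> (Suc i)) :: 'a fps)"
  define Q where "Q = qpoch (z * fps_X) (\<nu> (k - 1)) * qpoch (inverse z * fps_X) (\<nu> (k - 1))"
  have P: "inverse P = (\<Prod>i=1..<k-1. qfact_inv (\<nu> i - \<nu> (Suc i)))"
    by (simp add: P_def inverse_prod_fps qfact_inv_def)
  have "fps_nth (\<Prod>i\<in>I. qpoch fps_X (h i) :: 'a fps) 0 = 1" for h and I :: "nat set"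
    by (induction I rule: infinite_finite_induct) (simp_all add: qpoch_nth_0)
  then have "fps_nth P 0 = 1" by (simp only: P_def)
  moreover have "fps_nth Q 0 = 1"
    by (simp add: Q_def qpoch_nth_0)
  ultimately have div: "F / (P * Q) = F * (inverse P * inverse Q)" for F
    by (simp add: fps_divide_unit fps_inverse_mult)
  have "multisum_term (fps_const c) z k \<nu> =
     (fps_const c ^ \<nu> 1 * qpoch (- 1 / fps_const c) (\<nu> 1)) * fps_X ^ (Suc (\<nu> 1) choose 2)
     * fps_X ^ (\<Sum>i=2..k-1. (\<nu> i)\<^sup>2) / (P * Q)"
    unfolding multisum_term_def P_def Q_def by (simp only: power_add mult_ac Suc_eq_plus1)
  also have "\<dots> = (\<Prod>i<\<nu> 1. fps_const c + fps_X ^ i) * fps_X ^ (Suc (\<nu> 1) choose 2)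
     * fps_X ^ (\<Sum>i=2..k-1. (\<nu> i)\<^sup>2) * (inverse P * inverse Q)"
    unfolding power_mult_qpoch[OF \<open>c \<noteq> 0\<close>] div ..
  also have "inverse Q = Bailey_beta z (\<nu> (k - 1))"
    using pos by (simp add: Q_def Bailey_beta_def)
  finally show ?thesis by (simp only: P mult_ac)
qed

text \<open>Tuples are grouped by their first entry. By \<open>sum_desc_tuples\<close> each group is
  a term of the left-hand sum in \<open>Bailey_lemma_limit\<close>, with the iterated
  \<open>Bailey_beta\<close> as \<beta>.\<close>

lemma has_sum_multisum:
  fixes c :: "'a::field"
  assumes c: "c \<noteq> 0" and k: "k \<ge> 2" and z: "fps_nth z 0 \<noteq> 0"
  shows "(multisum_term (fps_const c) z k has_sum
     Abs_fps (\<lambda>N. fps_nth (multisum_trunc (fps_const c) z k N) N)) (desc_tuples (k - 1))"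
proof (rule fps_has_sum_fibres[where h = "\<lambda>\<nu>. \<nu> 1"])
  let ?a = "fps_const c"
  obtain j where j: "k - 1 = Suc j" "k - 2 = j" using k by (intro that[of "k - 2"]) auto
  define \<beta> where "\<beta> = ((\<lambda>g n. \<Sum>s=1..n. fps_X ^ s\<^sup>2 * qfact_inv (n - s) * g s) ^^ j) (Bailey_beta z)"
  have \<beta>: "\<beta> n = (\<Sum>r=1..n. (fps_X ^ (j * r\<^sup>2) * Bailey_alpha z r) * qfact_inv (n - r) * qfact_inv (n + r))" for n
    unfolding \<beta>_def by (rule Bailey_lemma_iterate) (rule Bailey_pair[OF z])
  show "finite {\<nu> \<in> desc_tuples (k - 1). \<nu> 1 = m}" for m
    unfolding j by (rule finite_desc_tuples)
  show "fps_nth (multisum_term ?a z k \<nu>) n = 0" if "\<nu> \<in> desc_tuples (k - 1)" "n < \<nu> 1" for \<nu> n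
  proof -
    have "n < Suc (\<nu> 1) choose 2" using that(2) choose_2_ge[of "\<nu> 1"] by simp
    then show ?thesis
      unfolding multisum_term_eq[OF c k that(1)]
      by (simp only: mult.commute[of _ "fps_X ^ (Suc (\<nu> 1) choose 2)"] mult.assoc fps_X_power_mult_nth if_True)
  qed
  have fibre: "(\<Sum>\<nu> | \<nu> \<in> desc_tuples (k - 1) \<and> \<nu> 1 = n. multisum_term ?a z k \<nu>) =
      (\<Prod>i<n. ?a + fps_X ^ i) * fps_X ^ (Suc n choose 2) * \<beta> n" if "n \<ge> 1" for n
  proof -
    have "(\<Sum>\<nu> | \<nu> \<in> desc_tuples (k - 1) \<and> \<nu> 1 = n. multisum_term ?a z k \<nu>) =
      (\<Sum>\<nu> | \<nu> \<in> desc_tuples (k - 1) \<and> \<nu> 1 = n. (\<Prod>i<n. ?a + fps_X ^ i) * fps_X ^ (Suc n choose 2) *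
      (fps_X ^ (\<Sum>i=2..k-1. (\<nu> i)\<^sup>2) * (\<Prod>i=1..<k-1. qfact_inv (\<nu> i - \<nu> (Suc i))) * Bailey_beta z (\<nu> (k - 1))))"
      using multisum_term_eq[OF c k] by (intro sum.cong refl) auto
    then show ?thesis
      unfolding sum_distrib_left[symmetric] j \<beta>_def sum_desc_tuples[OF that] .
  qed
  fix N
  have "(\<Sum>n\<le>N. \<Sum>\<nu> | \<nu> \<in> desc_tuples (k - 1) \<and> \<nu> 1 = n. multisum_term ?a z k \<nu>) =
      (\<Sum>n=1..N. \<Sum>\<nu> | \<nu> \<in> desc_tuples (k - 1) \<and> \<nu> 1 = n. multisum_term ?a z k \<nu>)"
  proof (rule sum.mono_neutral_right)
    show "\<forall>n\<in>{..N} - {1..N}. (\<Sum>\<nu> | \<nu> \<in> desc_tuples (k - 1) \<and> \<nu> 1 = n. multisum_term ?a z k \<nu>) = 0"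
    proof
      fix n assume "n \<in> {..N} - {1..N}"
      then have "n = 0" by auto
      then show "(\<Sum>\<nu> | \<nu> \<in> desc_tuples (k - 1) \<and> \<nu> 1 = n. multisum_term ?a z k \<nu>) = 0"
        using desc_tuples_eq_0[of "k - 1"] k by (simp only:) simp
    qed
  qed auto
  also have "\<dots> = (\<Sum>n=1..N. (\<Prod>i<n. ?a + fps_X ^ i) * fps_X ^ (Suc n choose 2) * \<beta> n)"
    by (intro sum.cong refl fibre) simp
  finally show "fps_nth (Abs_fps (\<lambda>N. fps_nth (multisum_trunc ?a z k N) N)) N =
     fps_nth (\<Sum>n\<le>N. \<Sum>\<nu> | \<nu> \<in> desc_tuples (k - 1) \<and> \<nu> 1 = n. multisum_term ?a z k \<nu>) N"
    using fps_X_power_Suc_dvd_diffD[OF Bailey_lemma_limit[OF \<beta>, where N = N and a = ?a]]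
    by (simp add: multisum_trunc_def j)
qed

section \<open>Truncation of the generating series of \<open>Nbar\<close>\<close>

definition Nbar_trunc :: "'a::field fps \<Rightarrow> nat \<Rightarrow> int \<Rightarrow> nat \<Rightarrow> 'a fps" where
  "Nbar_trunc a k m N = qpoch (- a * fps_X) N * qfact_inv N *
    (\<Sum>n=1..N. (-1) ^ (n - 1) * (\<Prod>i<n. a + fps_X ^ i) * fps_X ^ ((k - 1) * n\<^sup>2 + nat \<bar>m\<bar> * n) * (1 - fps_X ^ n)
       * inverse (qpoch (- a * fps_X) n))"

lemma Nbar_series_nth:
  fixes c :: "'a::field"
  assumes c: "c \<noteq> 0" and k: "k \<ge> 2"
  shows "fps_nth (Nbar_series (fps_const c) k m) N = fps_nth (Nbar_trunc (fps_const c) k m N) N"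
proof -
  let ?a = "fps_const c"
  let ?e = "\<lambda>n. (k - 1) * n\<^sup>2 + nat \<bar>m\<bar> * n"
  let ?f = "\<lambda>n. (-1) ^ (n - 1) * ?a ^ n * fps_X ^ ?e n * (1 - fps_X ^ n) * (qpoch (- 1 / ?a) n / qpoch (- ?a * fps_X) n)"
  let ?g = "\<lambda>n. (-1) ^ (n - 1) * (\<Prod>i<n. ?a + fps_X ^ i) * fps_X ^ ?e n * (1 - fps_X ^ n) * inverse (qpoch (- ?a * fps_X) n)"
  have fg: "?f n = ?g n" for n
    unfolding power_mult_qpoch[OF c, symmetric] by (simp add: fps_divide_unit qpoch_nth_0 mult_ac)
  have dvd: "fps_X ^ n dvd ?g n" for n
  proof -
    have "1 * n \<le> (k - 1) * n\<^sup>2" using k by (intro mult_le_mono) (auto simp: power2_eq_square)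
    then have "n \<le> ?e n" by simp
    then have "fps_X ^ n dvd (fps_X ^ ?e n :: 'a fps)" by (rule le_imp_power_dvd)
    then show ?thesis by (rule dvd_mult2[OF dvd_mult2[OF dvd_mult]])
  qed
  \<comment> \<open>The term of index \<open>n\<close> has order at least \<open>n\<close>, so
    summing up to \<open>N\<close> already gives the final coefficient \<open>N\<close>.\<close>
  define S where "S = Abs_fps (\<lambda>N. fps_nth (\<Sum>n=1..N. ?g n) N)"
  have "(?g has_sum S) {1..}"
  proof (rule fps_has_sum_fibres[where h = "\<lambda>n. n"])
    show "fps_nth (?g n) N = 0" if "N < n" for n N
      using dvd[of n] that unfolding fps_X_power_dvd_iff by blast
    have "(\<Sum>n | n \<in> {1..} \<and> n = m. ?g n) = (if m \<ge> 1 then ?g m else 0)" for m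
    proof -
      have "{n. n \<in> {1..} \<and> n = m} = (if m \<ge> 1 then {m} else {})" by auto
      then show ?thesis by simp
    qed
    then have "(\<Sum>m\<le>N. \<Sum>n | n \<in> {1..} \<and> n = m. ?g n) = (\<Sum>m\<le>N. if m \<ge> 1 then ?g m else 0)" for N
      by simp
    also have "\<dots> N = (\<Sum>m=1..N. ?g m)" for N
      by (rule sum.mono_neutral_cong_right) auto
    finally show "fps_nth S N = fps_nth (\<Sum>m\<le>N. \<Sum>n | n \<in> {1..} \<and> n = m. ?g n) N" for N
      by (simp add: S_def)
  qed auto
  then have "infsum ?f {1..} = S" unfolding fg by (rule infsumI)
  moreover have "fps_X ^ Suc N dvd S - (\<Sum>n=1..N. ?g n)"
    unfolding fps_X_power_dvd_iff
  proof (intro allI impI)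
    fix i assume i: "i < Suc N"
    have "(\<Sum>n=1..N. fps_nth (?g n) i) = (\<Sum>n=1..i. fps_nth (?g n) i)"
      using i dvd unfolding fps_X_power_dvd_iff by (intro sum.mono_neutral_right) auto
    then show "fps_nth (S - (\<Sum>n=1..N. ?g n)) i = 0"
      by (simp add: S_def fps_sum_nth)
  qed
  moreover have "fps_X ^ Suc N dvd inverse (qpoch_inf fps_X) - (qfact_inv N :: 'a fps)"
    unfolding qfact_inv_def
    by (intro dvd_diff_inverse_cong fps_X_power_dvd_qpoch_inf_diff) (simp_all add: has_prod_qpoch_inf(2) qpoch_nth_0)
  moreover have "fps_X ^ Suc N dvd qpoch_inf (- ?a * fps_X) - qpoch (- ?a * fps_X) N"
    by (rule fps_X_power_dvd_qpoch_inf_diff) simp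
  ultimately have "fps_X ^ Suc N dvd Nbar_series ?a k m - Nbar_trunc ?a k m N"
    unfolding Nbar_series_def Nbar_trunc_def
    by (subst fps_divide_unit) (auto simp: has_prod_qpoch_inf(2) qpoch_nth_0 intro!: dvd_diff_mult_cong simp del: power_Suc)
  then show ?thesis by (rule fps_X_power_Suc_dvd_diffD)
qed

text \<open>Every term has \<open>n \<ge> 1\<close> and hence order at least the absolute value of
  \<open>m\<close>. This leaves only finitely many \<open>m\<close> for each power of
  \<open>q\<close>.\<close>

lemma Nbar_series_nth_eq_0:
  fixes c :: "'a::field"
  assumes "c \<noteq> 0" and "k \<ge> 2" and "nat \<bar>m\<bar> > N"
  shows "fps_nth (Nbar_series (fps_const c) k m) N = 0"
proof -
  have "fps_X ^ Suc N dvd Nbar_trunc (fps_const c) k m N"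
    unfolding Nbar_trunc_def
  proof (rule dvd_mult, rule dvd_sum)
    fix n assume n: "n \<in> {1..N}"
    have "Suc N * 1 \<le> nat \<bar>m\<bar> * n" using assms n by (intro mult_le_mono) auto
    then have "Suc N \<le> (k - 1) * n\<^sup>2 + nat \<bar>m\<bar> * n" by simp
    then have "fps_X ^ Suc N dvd (fps_X ^ ((k - 1) * n\<^sup>2 + nat \<bar>m\<bar> * n) :: 'a fps)" by (rule le_imp_power_dvd)
    then show "fps_X ^ Suc N dvd (-1) ^ (n - 1) * (\<Prod>i<n. fps_const c + fps_X ^ i) * fps_X ^ ((k - 1) * n\<^sup>2 + nat \<bar>m\<bar> * n) * (1 - fps_X ^ n)
       * inverse (qpoch (- fps_const c * fps_X) n)"
      by (rule dvd_mult2[OF dvd_mult2[OF dvd_mult]])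
  qed
  then show ?thesis
    unfolding Nbar_series_nth[OF assms(1,2)] fps_X_power_dvd_iff by simp
qed

section \<open>The two-sided geometric series in \<open>z\<close>\<close>

lemma sum_powi_symmetric_eq:
  fixes z y :: "'a::field fps"
  assumes z: "fps_nth z 0 \<noteq> 0"
  shows "(1 - z * y) * (1 - inverse z * y) * (\<Sum>m=-int M..int M. z powi m * y ^ nat \<bar>m\<bar>)
    = 1 - y\<^sup>2 - y ^ Suc M * (z ^ Suc M + inverse z ^ Suc M) + y ^ (M + 2) * (z ^ M + inverse z ^ M)"
proof -
  define w where "w = inverse z"
  have zw: "z * w = 1" using z by (simp add: w_def inverse_mult_eq_1')
  have "(1 - z * y) * (1 - w * y) * (\<Sum>m=-int M..int M. z powi m * y ^ nat \<bar>m\<bar>)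
    = 1 - y\<^sup>2 - y ^ Suc M * (z ^ Suc M + w ^ Suc M) + y ^ (M + 2) * (z ^ M + w ^ M)"
  proof (induction M)
    case 0
    show ?case using zw by (simp add: power2_eq_square) algebra
  next
    case (Suc M)
    have "{-int (Suc M)..int (Suc M)} = insert (- int (Suc M)) (insert (int (Suc M)) {-int M..int M})"
      by auto
    then have "(\<Sum>m=-int (Suc M)..int (Suc M). z powi m * y ^ nat \<bar>m\<bar>) =
        (\<Sum>m=-int M..int M. z powi m * y ^ nat \<bar>m\<bar>) + (z ^ Suc M + w ^ Suc M) * y ^ Suc M"
      by (simp add: power_int_def w_def nat_add_distrib algebra_simps)
    then have "(1 - z * y) * (1 - w * y) * (\<Sum>m=-int (Suc M)..int (Suc M). z powi m * y ^ nat \<bar>m\<bar>) =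
       1 - y\<^sup>2 - y ^ Suc M * (z ^ Suc M + w ^ Suc M) + y ^ (M + 2) * (z ^ M + w ^ M)
       + (1 - z * y) * (1 - w * y) * ((z ^ Suc M + w ^ Suc M) * y ^ Suc M)"
      by (simp only: distrib_left Suc)
    also have "\<dots> = 1 - y\<^sup>2 - y ^ Suc (Suc M) * (z ^ Suc (Suc M) + w ^ Suc (Suc M)) + y ^ (Suc M + 2) * (z ^ Suc M + w ^ Suc M)"
    proof -
      \<comment> \<open>\<open>Y\<close>, \<open>Z\<close> and \<open>W\<close> stand for the
        \<open>M\<close>-th powers of \<open>y\<close>, \<open>z\<close> and \<open>w\<close>; what
        remains is polynomial and uses only \<open>z * w = 1\<close>.\<close>
      have "1 - y\<^sup>2 - y * Y * (z * Z + w * W) + Y * y\<^sup>2 * (Z + W) + (1 - z * y) * (1 - w * y) * ((z * Z + w * W) * (y * Y))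
        = 1 - y\<^sup>2 - y * (y * Y) * (z * (z * Z) + w * (w * W)) + y * (Y * y\<^sup>2) * (z * Z + w * W)" for Y Z W
      proof -
        have 1: "(1 - z * y) * (1 - w * y) = 1 - (z + w) * y + y\<^sup>2"
          using zw by algebra
        have 2: "z * (z * Z) + w * (w * W) = (z * Z + w * W) * (z + w) - (Z + W)"
          using zw by algebra
        show ?thesis unfolding 1 2 by (simp add: algebra_simps power2_eq_square)
      qed
      then show ?thesis unfolding power_Suc power_add add_Suc .
    qed
    finally show ?case .
  qed
  then show ?thesis by (simp add: w_def)
qed

text \<open>The boundary terms of the finite sum carry at least \<open>y ^ Suc M\<close> with
  \<open>y = fps_X ^ n\<close>, hence vanish modulo \<open>fps_X ^ Suc M\<close>.\<close>

lemma sum_powi_symmetric_cong: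
  fixes z :: "'a::field fps"
  assumes z: "fps_nth z 0 \<noteq> 0" and n: "n \<ge> 1"
  shows "fps_X ^ Suc M dvd (\<Sum>m=-int M..int M. z powi m * fps_X ^ (nat \<bar>m\<bar> * n))
     - (1 - fps_X ^ (2 * n)) * inverse (rank_factor z n)" (is "_ dvd ?S - ?R")
proof -
  let ?y = "fps_X ^ n :: 'a fps"
  have S: "?S = (\<Sum>m=-int M..int M. z powi m * ?y ^ nat \<bar>m\<bar>)"
    by (simp add: power_mult[symmetric] mult.commute)
  have "rank_factor z n * ?S - (1 - fps_X ^ (2 * n)) =
      ?y ^ Suc M * (?y * (z ^ M + inverse z ^ M) - (z ^ Suc M + inverse z ^ Suc M))"
    unfolding S rank_factor_def sum_powi_symmetric_eq[OF z]
    by (simp add: algebra_simps power_mult[symmetric] power2_eq_square mult_2_right power_add)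
  moreover have "fps_X ^ Suc M dvd ?y ^ Suc M"
    unfolding power_mult[symmetric] using n by (intro le_imp_power_dvd) (cases n, auto)
  ultimately have "fps_X ^ Suc M dvd inverse (rank_factor z n) * (rank_factor z n * ?S - (1 - fps_X ^ (2 * n)))"
    by (simp del: power_Suc)
  also have "inverse (rank_factor z n) * (rank_factor z n * ?S - (1 - fps_X ^ (2 * n)))
     = (inverse (rank_factor z n) * rank_factor z n) * ?S - ?R"
    by (simp add: algebra_simps)
  also have "inverse (rank_factor z n) * rank_factor z n = 1"
    using n by (simp add: inverse_mult_eq_1 rank_factor_nth_0)
  finally show ?thesis by simp
qed

text \<open>After exchanging the sums over \<open>m\<close> and \<open>n\<close>, the sum over
  \<open>m\<close> produces the \<open>z\<close>-dependent part of
  \<open>Bailey_alpha\<close>.\<close>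

lemma sum_Nbar_trunc_cong:
  fixes z a :: "'a::field fps"
  assumes z: "fps_nth z 0 \<noteq> 0" and k: "k \<ge> 2"
  shows "fps_X ^ Suc N dvd (\<Sum>m=-int N..int N. z powi m * Nbar_trunc a k m N) - multisum_trunc a z k N"
proof -
  define C where "C n = (-1) ^ (n - 1) * (\<Prod>i<n. a + fps_X ^ i) * fps_X ^ ((k - 1) * n\<^sup>2) * (1 - fps_X ^ n)
       * inverse (qpoch (- a * fps_X) n)" for n
  define P where "P = qpoch (- a * fps_X) N * qfact_inv N"
  have "(\<Sum>m=-int N..int N. z powi m * Nbar_trunc a k m N) =
      (\<Sum>m=-int N..int N. \<Sum>n=1..N. P * C n * (z powi m * fps_X ^ (nat \<bar>m\<bar> * n)))"
    unfolding Nbar_trunc_def C_def P_def sum_distrib_left power_add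
    by (intro sum.cong refl) (simp only: mult_ac)
  also have "\<dots> = (\<Sum>n=1..N. P * C n * (\<Sum>m=-int N..int N. z powi m * fps_X ^ (nat \<bar>m\<bar> * n)))"
    unfolding sum_distrib_left by (rule sum.swap)
  finally have 1: "(\<Sum>m=-int N..int N. z powi m * Nbar_trunc a k m N) = \<dots>" .
  \<comment> \<open>The three factors come from the final Bailey step, the \<open>k - 2\<close>
    earlier ones and \<open>Bailey_numerator\<close>.\<close>
  have exp: "fps_X ^ (Suc n choose 2) * fps_X ^ ((k - 2) * n\<^sup>2) * fps_X ^ (n choose 2) = (fps_X ^ ((k - 1) * n\<^sup>2) :: 'a fps)" for n
  proof -
    have "k - 1 = Suc (k - 2)" using k by simp
    then have "(k - 1) * n\<^sup>2 = (Suc n choose 2) + (k - 2) * n\<^sup>2 + (n choose 2)"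
      using square_eq_choose_2[of n] by (simp only: mult_Suc)
    then show ?thesis by (simp only: power_add)
  qed
  have 2: "multisum_trunc a z k N = (\<Sum>n=1..N. P * C n * ((1 - fps_X ^ (2 * n)) * inverse (rank_factor z n)))"
    unfolding multisum_trunc_def C_def P_def sum_distrib_left Bailey_alpha_def Bailey_numerator_def exp[symmetric]
    by (intro sum.cong refl) (simp only: mult_ac)
  show ?thesis
    unfolding 1 2 sum_subtractf[symmetric] right_diff_distrib[symmetric]
    by (intro dvd_sum dvd_mult sum_powi_symmetric_cong[OF z]) simp
qed

subsection \<open>Extension of scalars\<close>

text \<open>\<open>Nbar\<close> is defined over Laurent series in \<open>a\<close> alone, while the
  theorem also has \<open>z\<close> in its coefficient field. This is the coefficientwise embedding,
  which fixes \<open>q\<close>.\<close>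

definition fps_map_const :: "'a::field fps \<Rightarrow> 'a fls fps" where
  "fps_map_const F = Abs_fps (\<lambda>n. fls_const (fps_nth F n))"

lemma fls_const_sum: "fls_const (\<Sum>i\<in>I. f i) = (\<Sum>i\<in>I. fls_const (f i))"
  for f :: "'b \<Rightarrow> 'a::field"
  by (induction I rule: infinite_finite_induct) (simp_all add: fls_plus_const[symmetric])

lemma fps_map_const_add: "fps_map_const (F + G) = fps_map_const F + fps_map_const G"
  and fps_map_const_diff: "fps_map_const (F - G) = fps_map_const F - fps_map_const G"
  and fps_map_const_uminus: "fps_map_const (- F) = - fps_map_const F"
  and fps_map_const_1: "fps_map_const 1 = 1"
  and fps_map_const_0: "fps_map_const 0 = 0"
  and fps_map_const_X: "fps_map_const fps_X = fps_X"
  and fps_map_const_const: "fps_map_const (fps_const c) = fps_const (fls_const c)"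
  by (simp_all add: fps_map_const_def fps_eq_iff fls_plus_const[symmetric] fls_minus_const[symmetric] fps_X_nth)

lemma fps_map_const_mult: "fps_map_const (F * G) = fps_map_const F * fps_map_const G"
  by (simp add: fps_map_const_def fps_eq_iff fps_mult_nth fls_const_sum)

lemma fps_map_const_power: "fps_map_const (F ^ n) = fps_map_const F ^ n"
  by (induction n) (simp_all add: fps_map_const_1 fps_map_const_mult)

lemma fps_map_const_sum: "fps_map_const (\<Sum>i\<in>I. f i) = (\<Sum>i\<in>I. fps_map_const (f i))"
  by (induction I rule: infinite_finite_induct) (simp_all add: fps_map_const_0 fps_map_const_add)

lemma fps_map_const_prod: "fps_map_const (\<Prod>i\<in>I. f i) = (\<Prod>i\<in>I. fps_map_const (f i))"
  by (induction I rule: infinite_finite_induct) (simp_all add: fps_map_const_1 fps_map_const_mult)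

lemma fps_map_const_inverse:
  assumes "fps_nth F 0 \<noteq> 0"
  shows "fps_map_const (inverse F) = inverse (fps_map_const F)"
proof (rule fps_inverse_unique[symmetric])
  show "fps_map_const F * fps_map_const (inverse F) = 1"
    using assms by (simp add: fps_map_const_mult[symmetric] inverse_mult_eq_1' fps_map_const_1)
qed

lemma fps_map_const_qpoch: "fps_map_const (qpoch x n) = qpoch (fps_map_const x) n"
  by (simp add: qpoch_def fps_map_const_prod fps_map_const_diff fps_map_const_1 fps_map_const_mult
      fps_map_const_power fps_map_const_X)

text \<open>The truncation is a finite expression in sums, products and inverses of units, so a ring
  homomorphism carries it over.\<close>

lemma fps_map_const_Nbar_trunc:
  "fps_map_const (Nbar_trunc (fps_const c) k m N) = Nbar_trunc (fps_const (fls_const c)) k m N"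
  by (simp add: Nbar_trunc_def qfact_inv_def fps_map_const_mult fps_map_const_sum fps_map_const_prod
      fps_map_const_power fps_map_const_add fps_map_const_diff fps_map_const_uminus fps_map_const_1
      fps_map_const_X fps_map_const_const fps_map_const_inverse fps_map_const_qpoch qpoch_nth_0
      del: fps_const_neg fps_const_minus)

lemma of_rat_fls: "(of_rat c :: 'a::field_char_0 fls) = fls_const (of_rat c)"
proof -
  obtain u v where c: "c = of_int u / of_int v" and v: "v \<noteq> 0"
    by (metis quotient_of_denom_pos quotient_of_div surj_pair less_irrefl)
  show ?thesis using v
    by (simp add: c of_rat_divide fls_const_divide_const[symmetric] fls_of_int)
qed

text \<open>By \<open>poly_coeffs_Nbar_series\<close> each coefficient is a polynomial in
  \<open>a\<close>, so the numbers \<open>Nbar\<close> with natural \<open>j\<close> determine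
  it.\<close>

lemma Nbar_polynomial:
  shows "finite {j. Nbar k m n j \<noteq> 0}"
    and "fps_nth (Nbar_series (fps_const fls_X) k m) n = (\<Sum>j | Nbar k m n j \<noteq> 0. fls_const (Nbar k m n j) * fls_X ^ j)"
proof -
  obtain p where p: "fps_nth (Nbar_series (fps_const fls_X) k m) n = fps_to_fls (fps_of_poly (p :: rat poly))"
    using poly_coeffs_Nbar_series[where 'a = rat, of k m] by (auto simp: poly_coeffs_def)
  have N: "Nbar k m n j = coeff p j" for j
    by (simp add: Nbar_def p)
  show fin: "finite {j. Nbar k m n j \<noteq> 0}"
    unfolding N by (rule finite_subset[of _ "{..degree p}"]) (auto intro: le_degree)
  show "fps_nth (Nbar_series (fps_const fls_X) k m) n = (\<Sum>j | Nbar k m n j \<noteq> 0. fls_const (Nbar k m n j) * fls_X ^ j)"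
    unfolding p N
  proof (rule fls_eqI)
    fix i
    have "fls_nth (\<Sum>j | coeff p j \<noteq> 0. fls_const (coeff p j) * fls_X ^ j) i =
        (\<Sum>j | coeff p j \<noteq> 0. if i = int j then coeff p j else 0)"
      by (simp add: fls_nth_sum fls_X_power_nth if_distrib cong: if_cong)
    also have "\<dots> = (if i \<ge> 0 then coeff p (nat i) else 0)"
    proof (cases "i \<ge> 0")
      case True
      then obtain l where "i = int l" by (metis nat_0_le)
      then show ?thesis using fin by (simp add: N sum.delta)
    qed auto
    finally show "fls_nth (fps_to_fls (fps_of_poly p)) i =
        fls_nth (\<Sum>j | coeff p j \<noteq> 0. fls_const (coeff p j) * fls_X ^ j) i"
      by simp
  qed
qed

theorem theorem1p2:
  fixes k :: nat and a z q :: "rat fls fls fps"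
  assumes "k \<ge> 2"
    and "a = fps_const (fls_const fls_X)" and "z = fps_const fls_X" and "q = fps_X"
  shows "\<exists>S. ((\<lambda>(m, n, j). fps_const (of_rat (Nbar k m n j)) * a ^ j * q ^ n * z powi m) has_sum S)
               (UNIV :: (int \<times> nat \<times> nat) set)
           \<and> (multisum_term a z k has_sum S) (desc_tuples (k - 1))"
proof (intro exI conjI)
  define f where "f = (\<lambda>(m, n, j). fps_const (of_rat (Nbar k m n j)) * a ^ j * q ^ n * z powi m)"
  \<comment> \<open>The common value is read off along the diagonal: coefficient \<open>N\<close>
    from the truncation at \<open>N\<close>.\<close>
  let ?S = "Abs_fps (\<lambda>N. fps_nth (multisum_trunc a z k N) N)"
  have z: "fps_nth z 0 \<noteq> 0" by (simp add: assms)
  show "(multisum_term a z k has_sum ?S) (desc_tuples (k - 1))"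
    unfolding assms(2) by (rule has_sum_multisum[OF _ assms(1) z]) (simp add: fls_const_nonzero)
  have z_powi: "z powi m = fps_const (fls_X powi m)" for m
    by (simp add: assms power_int_def fps_const_power fps_const_inverse)
  have f_nth: "fps_nth (f (m, n, j)) i =
      (if i = n then fls_const (fls_const (Nbar k m n j) * fls_X ^ j) * fls_X powi m else 0)" for m n j i
    unfolding f_def prod.case z_powi assms(2,4)
    by (simp add: of_rat_fls fps_const_power fls_const_power fps_X_power_mult_right_nth
        fps_mult_right_const_nth flip: fls_const_mult_const)
  have vanish: "Nbar k m N j = 0" if "nat \<bar>m\<bar> > N" for m N j
    unfolding Nbar_def by (subst Nbar_series_nth_eq_0[OF _ assms(1) that]) simp_all
  define J where "J N m = {j. Nbar k m N j \<noteq> 0}" for N m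
  have finJ: "finite (J N m)" for N m
    unfolding J_def by (rule Nbar_polynomial(1))
  \<comment> \<open>At order \<open>N\<close> in \<open>q\<close>, \<open>vanish\<close> bounds
    \<open>m\<close> and polynomiality in \<open>a\<close> bounds \<open>j\<close>.\<close>
  have nz: "{x \<in> UNIV. fps_nth (f x) N \<noteq> 0} = (\<lambda>(m, j). (m, N, j)) ` (SIGMA m:{-int N..int N}. J N m)" for N
  proof -
    have "m \<in> {-int N..int N}" if "Nbar k m N j \<noteq> 0" for m j
      using that vanish[of N m j] by fastforce
    then show ?thesis
      by (auto simp: f_nth J_def image_iff fls_const_nonzero split: if_splits)
  qed
  have "(f has_sum ?S) UNIV"
  proof (rule fps_has_sumI)
    fix N
    show "finite {x \<in> UNIV. fps_nth (f x) N \<noteq> 0}"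
      unfolding nz using finJ by auto
    \<comment> \<open>The sum over \<open>j\<close> rebuilds a coefficient of
      \<open>Nbar_series\<close> over the smaller field; it is truncated there and then
      embedded.\<close>
    have coeff: "(\<Sum>j\<in>J N m. fls_const (fls_const (Nbar k m N j) * fls_X ^ j)) = fps_nth (Nbar_trunc a k m N) N" for m
    proof -
      have "(\<Sum>j\<in>J N m. fls_const (fls_const (Nbar k m N j) * fls_X ^ j)) =
          fls_const (fps_nth (Nbar_series (fps_const fls_X) k m) N)"
        unfolding J_def Nbar_polynomial(2) fls_const_sum ..
      also have "\<dots> = fls_const (fps_nth (Nbar_trunc (fps_const fls_X) k m N) N)"
        by (subst Nbar_series_nth[OF _ assms(1)]) simp_all
      also have "\<dots> = fps_nth (fps_map_const (Nbar_trunc (fps_const fls_X) k m N)) N"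
        by (simp add: fps_map_const_def)
      finally show ?thesis by (simp add: fps_map_const_Nbar_trunc assms)
    qed
    have "(\<Sum>x | x \<in> UNIV \<and> fps_nth (f x) N \<noteq> 0. fps_nth (f x) N) =
        (\<Sum>(m, j)\<in>(SIGMA m:{-int N..int N}. J N m). fps_nth (f (m, N, j)) N)"
      unfolding nz by (subst sum.reindex) (auto simp: inj_on_def intro!: sum.cong)
    also have "\<dots> = (\<Sum>m=-int N..int N. \<Sum>j\<in>J N m. fls_const (fls_const (Nbar k m N j) * fls_X ^ j) * fls_X powi m)"
      using finJ by (subst sum.Sigma) (simp_all only: f_nth if_True finite_atLeastAtMost_int ball_triv simp_thms)
    also have "\<dots> = (\<Sum>m=-int N..int N. fps_nth (z powi m * Nbar_trunc a k m N) N)"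
      unfolding sum_distrib_right[symmetric] coeff z_powi by (simp add: mult.commute)
    also have "\<dots> = fps_nth (multisum_trunc a z k N) N"
      using fps_X_power_Suc_dvd_diffD[OF sum_Nbar_trunc_cong[OF z assms(1), of N a]]
      by (simp add: fps_sum_nth)
    finally show "fps_nth ?S N = (\<Sum>x | x \<in> UNIV \<and> fps_nth (f x) N \<noteq> 0. fps_nth (f x) N)"
      by simp
  qed
  then show "((\<lambda>(m, n, j). fps_const (of_rat (Nbar k m n j)) * a ^ j * q ^ n * z powi m) has_sum ?S) UNIV"
    unfolding f_def .
qed

end
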